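(* Let $f\colon\mathbb{N}\to\mathbb{N}$ be a subexponential function (arbitrarily rapid). Let $F$ be a countable field. Then there exists a finitely generated nil algebra $R$ over $F$, with growth function $g_R$ (with respect to a suitable finite-dimensional generating subspace), such that: (1) for every $\varepsilon>0$, $g_R(n)\leq n^{6+\varepsilon}$ for infinitely many $n$; and (2) $g_R(n)\geq f(n)$ for infinitely many $n$.
   Context: $\mathbb{N}=\{1,2,\dots\}$. A non-decreasing function $f\colon\mathbb{N}\to\mathbb{N}$ is subexponential if $\limsup_{n\to\infty}\sqrt[n]{f(n)}=1$. Algebras are associative and not necessarily unital; an algebra is nil if every element of it is nilpotent. If an algebra $A$ over $F$ is generated by a finite-dimensional subspace $V$, its growth function with respect to $V$ is $g_A(n)=g_{A,V}(n)=\dim_F(F+V+V^2+\cdots+V^n)$ (computed in the unital hull of $A$ if $A$ is non-unital). *)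

theory Defs
  imports
    "HOL-Analysis.Analysis"
    "HOL-Algebra.Module"
    "HOL-Algebra.Ideal_Product"
    "HOL-Algebra.Embedded_Algebras"
begin

text \<open>Only the values at positive arguments matter; the value at \<open>0\<close> is unconstrained.\<close>

definition subexponential :: "(nat \<Rightarrow> nat) \<Rightarrow> bool" where
  "subexponential f \<longleftrightarrow>
     (\<forall>n\<ge>1. f n \<ge> 1) \<and> mono_on {1..} f \<and>
     limsup (\<lambda>n. ereal (root n (real (f n)))) = 1"

text \<open>
  Associative, not necessarily unital algebras over a field. The record type \<open>module\<close>
  comes with a field \<open>one\<close>; nothing is assumed about it here, and no definition below reads
  \<open>one A\<close> for an algebra \<open>A\<close>.
\<close>

locale assoc_algebra = module F A + field F
  for F :: "('k, 'm) ring_scheme" and A :: "('k, 'a, 'c) module_scheme" +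
  assumes mult_closed: "\<lbrakk>x \<in> carrier A; y \<in> carrier A\<rbrakk> \<Longrightarrow> x \<otimes>\<^bsub>A\<^esub> y \<in> carrier A"
    and mult_assoc: "\<lbrakk>x \<in> carrier A; y \<in> carrier A; z \<in> carrier A\<rbrakk> \<Longrightarrow>
      (x \<otimes>\<^bsub>A\<^esub> y) \<otimes>\<^bsub>A\<^esub> z = x \<otimes>\<^bsub>A\<^esub> (y \<otimes>\<^bsub>A\<^esub> z)"
    and distrib_right: "\<lbrakk>x \<in> carrier A; y \<in> carrier A; z \<in> carrier A\<rbrakk> \<Longrightarrow>
      (x \<oplus>\<^bsub>A\<^esub> y) \<otimes>\<^bsub>A\<^esub> z = x \<otimes>\<^bsub>A\<^esub> z \<oplus>\<^bsub>A\<^esub> y \<otimes>\<^bsub>A\<^esub> z"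
    and distrib_left: "\<lbrakk>x \<in> carrier A; y \<in> carrier A; z \<in> carrier A\<rbrakk> \<Longrightarrow>
      z \<otimes>\<^bsub>A\<^esub> (x \<oplus>\<^bsub>A\<^esub> y) = z \<otimes>\<^bsub>A\<^esub> x \<oplus>\<^bsub>A\<^esub> z \<otimes>\<^bsub>A\<^esub> y"
    and smult_mult_left: "\<lbrakk>c \<in> carrier F; x \<in> carrier A; y \<in> carrier A\<rbrakk> \<Longrightarrow>
      (c \<odot>\<^bsub>A\<^esub> x) \<otimes>\<^bsub>A\<^esub> y = c \<odot>\<^bsub>A\<^esub> (x \<otimes>\<^bsub>A\<^esub> y)"
    and smult_mult_right: "\<lbrakk>c \<in> carrier F; x \<in> carrier A; y \<in> carrier A\<rbrakk> \<Longrightarrow>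
      x \<otimes>\<^bsub>A\<^esub> (c \<odot>\<^bsub>A\<^esub> y) = c \<odot>\<^bsub>A\<^esub> (x \<otimes>\<^bsub>A\<^esub> y)"

text \<open>\<open>pos_power A x n\<close> is the power of \<open>x\<close> with exponent \<open>n + 1\<close>, which needs no unit.\<close>

primrec pos_power :: "('k, 'a, 'c) module_scheme \<Rightarrow> 'a \<Rightarrow> nat \<Rightarrow> 'a" where
  "pos_power A x 0 = x"
| "pos_power A x (Suc n) = pos_power A x n \<otimes>\<^bsub>A\<^esub> x"

definition nil_algebra :: "('k, 'a, 'c) module_scheme \<Rightarrow> bool" where
  "nil_algebra A \<longleftrightarrow> (\<forall>x\<in>carrier A. \<exists>n. pos_power A x n = \<zero>\<^bsub>A\<^esub>)"

definition finite_dim_subspace ::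
    "('k, 'm) ring_scheme \<Rightarrow> ('k, 'a, 'c) module_scheme \<Rightarrow> 'a set \<Rightarrow> bool" where
  "finite_dim_subspace F A V \<longleftrightarrow>
     (\<exists>X. finite X \<and> X \<subseteq> carrier A \<and> V = (\<lambda>W. submodule W F A) hull X)"

definition nonunital_subalgebra ::
    "('k, 'm) ring_scheme \<Rightarrow> ('k, 'a, 'c) module_scheme \<Rightarrow> 'a set \<Rightarrow> bool" where
  "nonunital_subalgebra F A B \<longleftrightarrow>
     submodule B F A \<and> (\<forall>x\<in>B. \<forall>y\<in>B. x \<otimes>\<^bsub>A\<^esub> y \<in> B)"

definition generating_subspace ::
    "('k, 'm) ring_scheme \<Rightarrow> ('k, 'a, 'c) module_scheme \<Rightarrow> 'a set \<Rightarrow> bool" where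
  "generating_subspace F A V \<longleftrightarrow>
     finite_dim_subspace F A V \<and> nonunital_subalgebra F A hull V = carrier A"

text \<open>
  Growth inside a unital ring \<open>R\<close> containing the base field as a subfield \<open>K\<close>.
  Although \<open>ideal_prod\<close> is named after ideals, it is by definition the set of all finite nonempty
  sums of products \<open>i \<otimes> j\<close>, hence the product of subspaces when applied to subspaces.
\<close>

primrec space_power :: "('b, 'c) ring_scheme \<Rightarrow> 'b set \<Rightarrow> 'b set \<Rightarrow> nat \<Rightarrow> 'b set" where
  "space_power R K V 0 = K"
| "space_power R K V (Suc n) = ideal_prod R (space_power R K V n) V"

primrec space_filtration :: "('b, 'c) ring_scheme \<Rightarrow> 'b set \<Rightarrow> 'b set \<Rightarrow> nat \<Rightarrow> 'b set" where
  "space_filtration R K V 0 = K"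
| "space_filtration R K V (Suc n) =
     space_filtration R K V n <+>\<^bsub>R\<^esub> space_power R K V (Suc n)"

definition growth_in_ring :: "('b, 'c) ring_scheme \<Rightarrow> 'b set \<Rightarrow> 'b set \<Rightarrow> nat \<Rightarrow> nat" where
  "growth_in_ring R K V n = ring.dim R K (space_filtration R K V n)"

text \<open>The pair \<open>(a, x)\<close> stands for \<open>a \<cdot> 1 + x\<close>.\<close>

definition unital_hull ::
    "('k, 'm) ring_scheme \<Rightarrow> ('k, 'a, 'c) module_scheme \<Rightarrow> ('k, 'k \<times> 'a) module" where
  "unital_hull F A =
     \<lparr>carrier = carrier F \<times> carrier A,
      mult = (\<lambda>(a, x) (b, y).
        (a \<otimes>\<^bsub>F\<^esub> b, a \<odot>\<^bsub>A\<^esub> y \<oplus>\<^bsub>A\<^esub> b \<odot>\<^bsub>A\<^esub> x \<oplus>\<^bsub>A\<^esub> x \<otimes>\<^bsub>A\<^esub> y)),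
      one = (\<one>\<^bsub>F\<^esub>, \<zero>\<^bsub>A\<^esub>),
      zero = (\<zero>\<^bsub>F\<^esub>, \<zero>\<^bsub>A\<^esub>),
      add = (\<lambda>(a, x) (b, y). (a \<oplus>\<^bsub>F\<^esub> b, x \<oplus>\<^bsub>A\<^esub> y)),
      smult = (\<lambda>c (a, x). (c \<otimes>\<^bsub>F\<^esub> a, c \<odot>\<^bsub>A\<^esub> x))\<rparr>"

definition is_identity :: "('k, 'a, 'c) module_scheme \<Rightarrow> 'a \<Rightarrow> bool" where
  "is_identity A e \<longleftrightarrow>
     e \<in> carrier A \<and> (\<forall>x\<in>carrier A. e \<otimes>\<^bsub>A\<^esub> x = x \<and> x \<otimes>\<^bsub>A\<^esub> e = x)"

text \<open>
  The growth function of \<open>A\<close> with respect to \<open>V\<close>: computed in \<open>A\<close> itself if \<open>A\<close> has an identity,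
  and in the unital hull of \<open>A\<close> otherwise.
\<close>

definition growth ::
    "('k, 'm) ring_scheme \<Rightarrow> ('k, 'a, 'c) module_scheme \<Rightarrow> 'a set \<Rightarrow> nat \<Rightarrow> nat" where
  "growth F A V n =
     (if \<exists>e. is_identity A e
      then let e = (THE e. is_identity A e)
           in growth_in_ring (A\<lparr>one := e\<rparr>) ((\<lambda>a. a \<odot>\<^bsub>A\<^esub> e) ` carrier F) V n
      else growth_in_ring (unital_hull F A) (carrier F \<times> {\<zero>\<^bsub>A\<^esub>}) ({\<zero>\<^bsub>F\<^esub>} \<times> V) n)"

text \<open>\<open>ring.dim\<close> is meaningful only over a subfield of a ring: the unital hull satisfies this.\<close>

lemma (in assoc_algebra) zero_mult [simp]:
  assumes "x \<in> carrier A"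
  shows "\<zero>\<^bsub>A\<^esub> \<otimes>\<^bsub>A\<^esub> x = \<zero>\<^bsub>A\<^esub>" and "x \<otimes>\<^bsub>A\<^esub> \<zero>\<^bsub>A\<^esub> = \<zero>\<^bsub>A\<^esub>"
  using assms
  by (metis M.zero_closed R.zero_closed mult_closed smult_mult_left smult_l_null,
      metis M.zero_closed R.zero_closed mult_closed smult_mult_right smult_l_null)

lemma (in assoc_algebra) ring_unital_hull: "ring (unital_hull F A)"
proof -
  note closed = mult_closed smult_closed
  note alg = mult_assoc distrib_right distrib_left smult_mult_left smult_mult_right
    smult_l_distr smult_r_distr smult_assoc1
  have smult_zero: "\<zero>\<^bsub>F\<^esub> \<odot>\<^bsub>A\<^esub> x = \<zero>\<^bsub>A\<^esub>" if "x \<in> carrier A" for x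
    using that by (rule smult_l_null)
  have comm: "a \<odot>\<^bsub>A\<^esub> (b \<odot>\<^bsub>A\<^esub> x) = b \<odot>\<^bsub>A\<^esub> (a \<odot>\<^bsub>A\<^esub> x)"
    if "a \<in> carrier F" "b \<in> carrier F" "x \<in> carrier A" for a b x
    using that by (metis smult_assoc1 R.m_comm)
  show ?thesis
  proof (rule ringI)
    show "abelian_group (unital_hull F A)"
    proof (rule abelian_groupI)
      fix p assume "p \<in> carrier (unital_hull F A)"
      then obtain a x where "p = (a, x)" "a \<in> carrier F" "x \<in> carrier A"
        by (auto simp: unital_hull_def)
      then show "\<exists>q\<in>carrier (unital_hull F A). q \<oplus>\<^bsub>unital_hull F A\<^esub> p = \<zero>\<^bsub>unital_hull F A\<^esub>"
        by (intro bexI[of _ "(\<ominus>\<^bsub>F\<^esub> a, \<ominus>\<^bsub>A\<^esub> x)"])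
           (auto simp: unital_hull_def R.l_neg M.l_neg)
    qed (auto simp: unital_hull_def R.a_ac M.a_ac)
    show "monoid (unital_hull F A)"
      by (rule monoidI)
         (auto simp: unital_hull_def closed alg R.m_assoc M.a_ac smult_zero comm)
  qed (auto simp: unital_hull_def closed alg R.l_distr R.r_distr M.a_ac)
qed

lemma (in assoc_algebra) subfield_unital_hull:
  "subfield (carrier F \<times> {\<zero>\<^bsub>A\<^esub>}) (unital_hull F A)"
proof -
  interpret U: ring "unital_hull F A" by (rule ring_unital_hull)
  let ?K = "carrier F \<times> {\<zero>\<^bsub>A\<^esub>}"
  have neg: "\<ominus>\<^bsub>unital_hull F A\<^esub> (a, \<zero>\<^bsub>A\<^esub>) = (\<ominus>\<^bsub>F\<^esub> a, \<zero>\<^bsub>A\<^esub>)" if "a \<in> carrier F" for a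
    by (rule U.minus_equality) (use that in \<open>auto simp: unital_hull_def R.l_neg\<close>)
  have sub: "subring ?K (unital_hull F A)"
    by (rule U.subringI) (auto simp: neg, auto simp: unital_hull_def)
  have comm: "subcring ?K (unital_hull F A)"
    by (rule U.subcringI[OF sub]) (auto simp: unital_hull_def R.m_comm)
  show ?thesis
  proof (rule U.subfieldI[OF comm])
    let ?S = "unital_hull F A\<lparr>carrier := ?K\<rparr>"
    show "Units ?S = ?K - {\<zero>\<^bsub>unital_hull F A\<^esub>}"
    proof (intro equalityI subsetI)
      fix p assume "p \<in> Units ?S"
      then show "p \<in> ?K - {\<zero>\<^bsub>unital_hull F A\<^esub>}"
        by (auto simp: Units_def unital_hull_def)
    next
      fix p assume "p \<in> ?K - {\<zero>\<^bsub>unital_hull F A\<^esub>}"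
      then obtain a where a: "p = (a, \<zero>\<^bsub>A\<^esub>)" "a \<in> carrier F" "a \<noteq> \<zero>\<^bsub>F\<^esub>"
        by (auto simp: unital_hull_def)
      then have "a \<in> Units F" by (simp add: field_Units)
      then obtain b where "b \<in> carrier F" "b \<otimes>\<^bsub>F\<^esub> a = \<one>\<^bsub>F\<^esub>" "a \<otimes>\<^bsub>F\<^esub> b = \<one>\<^bsub>F\<^esub>"
        by (auto simp: Units_def)
      then have "(b, \<zero>\<^bsub>A\<^esub>) \<in> ?K" "(b, \<zero>\<^bsub>A\<^esub>) \<otimes>\<^bsub>?S\<^esub> p = \<one>\<^bsub>?S\<^esub>" "p \<otimes>\<^bsub>?S\<^esub> (b, \<zero>\<^bsub>A\<^esub>) = \<one>\<^bsub>?S\<^esub>"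
        using a by (auto simp: unital_hull_def)
      then show "p \<in> Units ?S"
        unfolding Units_def using a by auto
    qed
  qed
qed

end

theory Submission
  imports Defs
begin

text \<open>
  The algebra is the free algebra on two letters modulo the largest ideal annihilated by a
  family of functionals on words. The family is built in stages. Stage \<open>j\<close> starts from two
  functionals \<open>p False\<close>, \<open>p True\<close> on words of length \<open>N\<close>. Their \<open>2 ^ t\<close> tensor products of length
  \<open>t * N\<close> all belong to the family; they are linearly independent, so for large \<open>t\<close> the growth at
  \<open>t * N\<close> exceeds the subexponential \<open>f\<close>.

  Let \<open>a\<close> be the \<open>j\<close>-th element of the free algebra. The condition that a functional annihilates
  everything a power of \<open>a\<close> can put into a block of length \<open>t * N\<close> is a system of linear equations
  whose number is only linear in \<open>t\<close>. Hence two independent combinations \<open>q False\<close>, \<open>q True\<close> of the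
  tensor products satisfy it, and as all later functionals are built from these two, a power of
  \<open>a\<close> vanishes in the quotient.

  The next stage starts from the tensor products of \<open>s - 1\<close> copies of \<open>q False\<close> with \<open>q False\<close> or
  \<open>q True\<close>. A subword of length at most \<open>s * t * N\<close> then meets at most two factors \<open>q True\<close>, which
  leaves \<open>O(s ^ 3)\<close> functionals on such subwords, with a constant that does not depend on \<open>s\<close>. Taking
  \<open>s\<close> huge pushes the growth at \<open>s * t * N\<close> below its sixth power.
\<close>

section \<open>Evaluation of formal sums of words\<close>

text \<open>Relations imposed on a free algebra might collapse it. Here control is on the dual side:
  one nonzero value of a test certifies survival, and annihilating a power of \<open>a\<close> only
  restricts which functionals are built later. The \<open>2 ^ t\<close> tensor products enter the
  family before the equations for \<open>a\<close> are solved, so rapid growth and nilness do not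
  compete. The equations are linear in number because a block sees a power of \<open>a\<close> only
  as a remnant of one word, a smaller power, and a head of another word. The remnant and the head
  are bounded in terms of \<open>a\<close> alone, and exponents beyond the block length give zero by
  support; so only the exponent range grows with \<open>t\<close>. The order of choices matters:
  \<open>f\<close> and \<open>a\<close> determine \<open>t\<close>, hence the block length, and only
  then is \<open>s\<close> chosen. All cost due to \<open>f\<close>, \<open>a\<close> and earlier
  stages is a constant that \<open>s\<close> dominates. With the free choice confined to the last of
  \<open>s\<close> factors, occurrences of \<open>q True\<close> are at least \<open>s\<close>
  blocks apart, while a window of \<open>s\<close> block lengths meets at most \<open>s + 1\<close>
  blocks.\<close>

context ring
begin

text \<open>
  A list of pairs \<open>(c, w)\<close> stands for the formal sum of the terms \<open>c w\<close>. Only the values of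
  linear functionals on such sums matter, so no normal form is needed.
\<close>

primrec ev :: "('a \<times> 'i) list \<Rightarrow> ('i \<Rightarrow> 'a) \<Rightarrow> 'a" where
  "ev [] \<phi> = \<zero>"
| "ev (x # r) \<phi> = fst x \<otimes> \<phi> (snd x) \<oplus> ev r \<phi>"

definition coeffs_in :: "('a \<times> 'i) list \<Rightarrow> bool" where
  "coeffs_in r \<longleftrightarrow> fst ` set r \<subseteq> carrier R"

lemma coeffs_in_simps [simp]:
  "coeffs_in []"
  "coeffs_in (x # r) \<longleftrightarrow> fst x \<in> carrier R \<and> coeffs_in r"
  "coeffs_in (r @ s) \<longleftrightarrow> coeffs_in r \<and> coeffs_in s"
  by (auto simp: coeffs_in_def)

lemma ev_closed [simp]:
  assumes "coeffs_in r" "\<And>w. w \<in> snd ` set r \<Longrightarrow> \<phi> w \<in> carrier R"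
  shows "ev r \<phi> \<in> carrier R"
  using assms by (induction r) auto

lemma ev_cong:
  assumes "\<And>w. w \<in> snd ` set r \<Longrightarrow> \<phi> w = \<psi> w"
  shows "ev r \<phi> = ev r \<psi>"
  using assms by (induction r) auto

lemma ev_append:
  assumes "coeffs_in r" "coeffs_in s" "\<And>w. \<phi> w \<in> carrier R"
  shows "ev (r @ s) \<phi> = ev r \<phi> \<oplus> ev s \<phi>"
  using assms by (induction r) (auto simp: a_assoc)

lemma ev_zero:
  assumes "coeffs_in r" "\<And>w. w \<in> snd ` set r \<Longrightarrow> \<phi> w = \<zero>"
  shows "ev r \<phi> = \<zero>"
  using assms by (induction r) auto

lemma ev_add:
  assumes "coeffs_in r" "\<And>w. \<phi> w \<in> carrier R" "\<And>w. \<psi> w \<in> carrier R"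
  shows "ev r (\<lambda>w. \<phi> w \<oplus> \<psi> w) = ev r \<phi> \<oplus> ev r \<psi>"
  using assms by (induction r) (auto simp: r_distr a_ac)

lemma ev_mult_right:
  assumes "coeffs_in r" "\<And>w. \<phi> w \<in> carrier R" "c \<in> carrier R"
  shows "ev r (\<lambda>w. \<phi> w \<otimes> c) = ev r \<phi> \<otimes> c"
  using assms by (induction r) (auto simp: l_distr m_assoc)

definition smul :: "'a \<Rightarrow> ('a \<times> 'i) list \<Rightarrow> ('a \<times> 'i) list" where
  "smul c r = map (\<lambda>x. (c \<otimes> fst x, snd x)) r"

lemma coeffs_in_smul [simp]: "coeffs_in r \<Longrightarrow> c \<in> carrier R \<Longrightarrow> coeffs_in (smul c r)"
  by (induction r) (auto simp: smul_def)

lemma snd_set_smul [simp]: "snd ` set (smul c r) = snd ` set r"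
  by (force simp: smul_def)

lemma ev_smul:
  assumes "coeffs_in r" "\<And>w. \<phi> w \<in> carrier R" "c \<in> carrier R"
  shows "ev (smul c r) \<phi> = c \<otimes> ev r \<phi>"
  using assms by (induction r) (auto simp: r_distr m_assoc smul_def)

section \<open>Products of formal sums\<close>

definition mul :: "('a \<times> 'x list) list \<Rightarrow> ('a \<times> 'x list) list \<Rightarrow> ('a \<times> 'x list) list" where
  "mul r s = concat (map (\<lambda>x. map (\<lambda>y. (fst x \<otimes> fst y, snd x @ snd y)) s) r)"

lemma coeffs_in_mul [simp]: "coeffs_in r \<Longrightarrow> coeffs_in s \<Longrightarrow> coeffs_in (mul r s)"
  by (auto simp: mul_def coeffs_in_def image_subset_iff)

lemma mul_Nil [simp]: "mul [] s = []"
  by (simp add: mul_def)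

text \<open>Both sides list the same products in the same order, so this is an equality of lists and
  not only of values.\<close>

lemma mul_assoc:
  assumes "coeffs_in r" "coeffs_in s" "coeffs_in t"
  shows "mul (mul r s) t = mul r (mul s t)"
proof -
  have app: "mul (r1 @ r2) t = mul r1 t @ mul r2 t" for r1 r2
    by (simp add: mul_def)
  show ?thesis
    using assms(1)
  proof (induction r)
    case (Cons x r)
    have "mul (map (\<lambda>y. (fst x \<otimes> fst y, snd x @ snd y)) s) t =
        map (\<lambda>y. (fst x \<otimes> fst y, snd x @ snd y)) (mul s t)"
      using assms(2)
    proof (induction s)
      case (Cons y s)
      moreover have "map (\<lambda>z. (fst x \<otimes> fst y \<otimes> fst z, (snd x @ snd y) @ snd z)) t =
          map (\<lambda>z. (fst x \<otimes> (fst y \<otimes> fst z), snd x @ snd y @ snd z)) t"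
        using assms(3) Cons.prems \<open>coeffs_in (x # r)\<close>
        by (auto simp: coeffs_in_def image_subset_iff m_assoc)
      ultimately show ?case
        by (simp add: mul_def o_def)
    qed simp
    moreover have "mul (x # r) s = map (\<lambda>y. (fst x \<otimes> fst y, snd x @ snd y)) s @ mul r s"
      "mul (x # r) (mul s t) = map (\<lambda>y. (fst x \<otimes> fst y, snd x @ snd y)) (mul s t) @ mul r (mul s t)"
      by (simp_all add: mul_def)
    ultimately show ?case
      using Cons by (simp add: app)
  qed simp
qed

text \<open>A finite Fubini theorem. Commutativity is a hypothesis because the context is only a
  \<open>ring\<close>.\<close>

lemma ev_swap:
  assumes "coeffs_in r" "coeffs_in s" "\<And>u v. \<psi> u v \<in> carrier R"
    and comm: "\<And>a b. a \<in> carrier R \<Longrightarrow> b \<in> carrier R \<Longrightarrow> a \<otimes> b = b \<otimes> a"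
  shows "ev r (\<lambda>u. ev s (\<lambda>v. \<psi> u v)) = ev s (\<lambda>v. ev r (\<lambda>u. \<psi> u v))"
  using assms(1)
proof (induction r)
  case Nil
  then show ?case using assms(2) by (simp add: ev_zero)
next
  case (Cons x r)
  have "fst x \<otimes> ev s (\<psi> (snd x)) = ev s (\<psi> (snd x)) \<otimes> fst x"
    using Cons.prems assms by (intro comm) auto
  also have "\<dots> = ev s (\<lambda>v. \<psi> (snd x) v \<otimes> fst x)"
    using Cons.prems assms(2,3) by (simp add: ev_mult_right)
  also have "\<dots> = ev s (\<lambda>v. fst x \<otimes> \<psi> (snd x) v)"
    by (rule ev_cong, rule comm) (use Cons.prems assms(2,3) in auto)
  finally show ?case
    using Cons assms(2,3) by (simp add: ev_add)
qed

lemma ev_mul: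
  assumes "coeffs_in r" "coeffs_in s" "\<And>w. \<phi> w \<in> carrier R"
  shows "ev (mul r s) \<phi> = ev r (\<lambda>u. ev s (\<lambda>v. \<phi> (u @ v)))"
  using assms(1)
proof (induction r)
  case (Cons x r)
  have "ev (map (\<lambda>y. (fst x \<otimes> fst y, snd x @ snd y)) s) \<phi> = fst x \<otimes> ev s (\<lambda>v. \<phi> (snd x @ v))"
    using assms(2)
    by (induction s) (use Cons.prems assms(3) in \<open>auto simp: r_distr m_assoc\<close>)
  moreover have "coeffs_in (map (\<lambda>y. (fst x \<otimes> fst y, snd x @ snd y)) s)"
    using assms(2) by (induction s) (use Cons.prems in auto)
  moreover have "mul (x # r) s = map (\<lambda>y. (fst x \<otimes> fst y, snd x @ snd y)) s @ mul r s"
    by (simp add: mul_def)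
  ultimately show ?case
    using Cons assms by (simp add: ev_append)
qed simp

lemma snd_set_mul: "snd ` set (mul r s) = (\<lambda>(u, v). u @ v) ` (snd ` set r \<times> snd ` set s)"
proof -
  have "snd ` set (mul r s) = (\<Union>x\<in>set r. (\<lambda>y. snd x @ snd y) ` set s)"
    by (simp add: mul_def image_UN image_image)
  also have "\<dots> = (\<lambda>(u, v). u @ v) ` (snd ` set r \<times> snd ` set s)"
    by (auto simp: image_iff)
  finally show ?thesis .
qed

lemma ev_finsum:
  assumes "coeffs_in r" "finite I" "\<And>i w. i \<in> I \<Longrightarrow> G i w \<in> carrier R"
  shows "ev r (\<lambda>w. \<Oplus>i\<in>I. G i w) = (\<Oplus>i\<in>I. ev r (G i))"
  using assms(1)
proof (induction r)
  case (Cons x r)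
  then show ?case
    using assms by (simp add: finsum_addf finsum_rdistr Pi_def)
qed (simp add: assms)

lemma ev_map_distinct:
  assumes "distinct xs" "\<And>i. i \<in> set xs \<Longrightarrow> c i \<in> carrier R" "\<And>i. i \<in> set xs \<Longrightarrow> g i \<in> carrier R"
  shows "ev (map (\<lambda>i. (c i, i)) xs) g = (\<Oplus>i\<in>set xs. c i \<otimes> g i)"
  using assms by (induction xs) auto

section \<open>Powers, and cutting a word at a given place\<close>

primrec pow :: "('a \<times> 'x list) list \<Rightarrow> nat \<Rightarrow> ('a \<times> 'x list) list" where
  "pow a 0 = [(\<one>, [])]"
| "pow a (Suc m) = mul a (pow a m)"

lemma coeffs_in_pow [simp]: "coeffs_in a \<Longrightarrow> coeffs_in (pow a m)"
  by (induction m) auto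

lemma length_pow:
  assumes "[] \<notin> snd ` set a" "w \<in> snd ` set (pow a m)"
  shows "m \<le> length w"
  using assms(2)
proof (induction m arbitrary: w)
  case (Suc m)
  then obtain u v where "w = u @ v" "u \<in> snd ` set a" "v \<in> snd ` set (pow a m)"
    by (auto simp: snd_set_mul)
  moreover have "u \<noteq> []"
    using calculation assms(1) by metis
  ultimately show ?case
    using Suc.IH[of v] by (cases u) auto
qed simp

text \<open>
  The sum of \<open>\<kappa> y y'\<close> over all splittings \<open>z = y @ y'\<close>. For \<open>\<kappa>\<close> supported on a single length of
  \<open>y\<close> it isolates the splitting at that place, but unlike \<open>take\<close> and \<open>drop\<close> it can be expanded
  along a product of words.
\<close>

primrec conv :: "('x list \<Rightarrow> 'x list \<Rightarrow> 'a) \<Rightarrow> 'x list \<Rightarrow> 'a" where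
  "conv \<kappa> [] = \<kappa> [] []"
| "conv \<kappa> (b # z) = \<kappa> [] (b # z) \<oplus> conv (\<lambda>y. \<kappa> (b # y)) z"

lemma conv_closed [simp]:
  "(\<And>y y'. \<kappa> y y' \<in> carrier R) \<Longrightarrow> conv \<kappa> z \<in> carrier R"
  by (induction z arbitrary: \<kappa>) auto

text \<open>Cuts inside \<open>w\<close>, its end included, contribute nothing, so the cut can be
  moved into \<open>z\<close>.\<close>

lemma conv_append:
  assumes "\<And>y y'. \<kappa> y y' \<in> carrier R" "\<And>e y'. e \<le> length w \<Longrightarrow> \<kappa> (take e w) y' = \<zero>"
  shows "conv \<kappa> (w @ z) = conv (\<lambda>y. \<kappa> (w @ y)) z"
  using assms
proof (induction w arbitrary: \<kappa>)
  case (Cons b w)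
  have "\<kappa> (take (Suc e) (b # w)) y' = \<zero>" if "e \<le> length w" for e y'
    using that by (intro Cons.prems(2)) auto
  then have "conv (\<lambda>y. \<kappa> (b # y)) (w @ z) = conv (\<lambda>y. \<kappa> (b # w @ y)) z"
    by (intro Cons.IH[of "\<lambda>y. \<kappa> (b # y)"]) (use Cons.prems in auto)
  then show ?case
    using Cons.prems(1) Cons.prems(2)[of 0] by simp
qed simp

lemma conv_ev:
  assumes "coeffs_in r" "\<And>w y y'. K w y y' \<in> carrier R"
  shows "ev r (\<lambda>w. conv (K w) z) = conv (\<lambda>y y'. ev r (\<lambda>w. K w y y')) z"
  using assms(2)
  by (induction z arbitrary: K) (auto simp: ev_add assms(1))

lemma conv_zero: "conv (\<lambda>y y'. \<zero>) z = \<zero>"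
  by (induction z) auto

lemma conv_single:
  assumes "n \<le> length z" "\<And>w. g w \<in> carrier R"
  shows "conv (\<lambda>y y'. if length y = n then g (y @ y') else \<zero>) z = g z"
  using assms
proof (induction z arbitrary: n g)
  case (Cons b z)
  show ?case
  proof (cases n)
    case 0
    then show ?thesis using Cons.prems by (simp add: conv_zero)
  next
    case (Suc m)
    then show ?thesis
      using Cons.IH[of m "\<lambda>w. g (b # w)"] Cons.prems by (simp cong: if_cong)
  qed
qed simp

end

context cring
begin

lemmas ev_swap' = ev_swap[OF _ _ _ m_comm]

text \<open>What precedes the cut in a product of words of \<open>a\<close> is a power of
  \<open>a\<close>, possibly followed by a head of the next factor; both are killed by hypothesis.
  The induction absorbs the first factor into \<open>\<kappa>\<close>, and the hypotheses survive
  this because they cover all exponents.\<close>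

lemma ev_pow_conv:
  assumes "coeffs_in a" "\<And>y y'. \<kappa> y y' \<in> carrier R"
    and "\<And>k y'. ev (pow a k) (\<lambda>z. \<kappa> z y') = \<zero>"
    and "\<And>k w e y'. w \<in> snd ` set a \<Longrightarrow> ev (pow a k) (\<lambda>z. \<kappa> (z @ take e w) y') = \<zero>"
  shows "ev (pow a m) (conv \<kappa>) = \<zero>"
  using assms(2-)
proof (induction m arbitrary: \<kappa>)
  case 0
  then show ?case using "0.prems"(2)[of 0 "[]"] by simp
next
  case (Suc m)
  note cl = Suc.prems(1)
  define \<kappa>' where "\<kappa>' = (\<lambda>y y'. ev a (\<lambda>w. \<kappa> (w @ y) y'))"
  have shift: "ev (pow a k) (\<lambda>z. \<kappa>' (z @ w) y') = ev (pow a (Suc k)) (\<lambda>z. \<kappa> (z @ w) y')" for k w y'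
    by (subst pow.simps, subst ev_mul)
       (use assms(1) cl in \<open>simp_all add: \<kappa>'_def ev_swap'[of _ a]\<close>)
  \<comment> \<open>Exponent \<open>0\<close> is the case of a cut inside the very first
    factor.\<close>
  have zero: "\<kappa> (take e w) y' = \<zero>" if "w \<in> snd ` set a" for e w y'
    using Suc.prems(3)[OF that, of 0 e y'] cl by simp
  have "ev (pow a (Suc m)) (conv \<kappa>) = ev a (\<lambda>w. ev (pow a m) (\<lambda>z. conv \<kappa> (w @ z)))"
    using assms(1) cl by (simp add: ev_mul)
  also have "\<dots> = ev a (\<lambda>w. ev (pow a m) (\<lambda>z. conv (\<lambda>y. \<kappa> (w @ y)) z))"
    by (intro ev_cong conv_append cl zero) auto
  also have "\<dots> = ev (pow a m) (\<lambda>z. ev a (\<lambda>w. conv (\<lambda>y. \<kappa> (w @ y)) z))"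
    by (rule ev_swap') (use assms(1) cl in auto)
  also have "\<dots> = ev (pow a m) (conv \<kappa>')"
    by (rule ev_cong, subst conv_ev) (use assms(1) cl in \<open>auto simp: \<kappa>'_def\<close>)
  also have "\<dots> = \<zero>"
  proof (rule Suc.IH)
    show "ev (pow a k) (\<lambda>z. \<kappa>' z y') = \<zero>" for k y'
      using shift[of k "[]" y'] Suc.prems(2) by (simp del: pow.simps)
    show "ev (pow a k) (\<lambda>z. \<kappa>' (z @ take e w) y') = \<zero>" if "w \<in> snd ` set a" for k w e y'
      using shift[of k "take e w" y'] Suc.prems(3) that by (simp del: pow.simps)
  qed (use assms(1) cl in \<open>auto simp: \<kappa>'_def\<close>)
  finally show ?case .
qed

end

section \<open>Homogeneous linear systems\<close>

context field
begin

text \<open>Gaussian elimination: a nonzero coefficient \<open>g j\<close> is the pivot, the other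
  equations lose the unknown \<open>j\<close>, and its value is recovered from \<open>g\<close> at
  the end.\<close>

lemma homogeneous_system_solution:
  assumes "finite I" "length gs < card I" "\<And>g i. g \<in> set gs \<Longrightarrow> i \<in> I \<Longrightarrow> g i \<in> carrier R"
  shows "\<exists>x. (\<forall>i. x i \<in> carrier R) \<and> (\<exists>i\<in>I. x i \<noteq> \<zero>) \<and> (\<forall>g\<in>set gs. (\<Oplus>i\<in>I. x i \<otimes> g i) = \<zero>)"
  using assms
proof (induction gs arbitrary: I rule: length_induct)
  case (1 gs)
  note IH = 1(1)[rule_format]
  show ?case
  proof (cases gs)
    case Nil
    then have "I \<noteq> {}" using 1 by auto
    then show ?thesis using Nil by (intro exI[of _ "\<lambda>_. \<one>"]) auto
  next
    case (Cons g hs)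
    have gc: "g i \<in> carrier R" if "i \<in> I" for i using 1(4) Cons that by auto
    have hc: "h i \<in> carrier R" if "h \<in> set hs" "i \<in> I" for h i using 1(4) Cons that by auto
    show ?thesis
    proof (cases "\<forall>i\<in>I. g i = \<zero>")
      case True
      obtain x where x: "\<forall>i. x i \<in> carrier R" "\<exists>i\<in>I. x i \<noteq> \<zero>"
        "\<forall>h\<in>set hs. (\<Oplus>i\<in>I. x i \<otimes> h i) = \<zero>"
        using IH[of hs I] 1(2,3) Cons hc by auto
      have "(\<Oplus>i\<in>I. x i \<otimes> g i) = (\<Oplus>i\<in>I. \<zero>)"
        by (rule finsum_cong') (use True x in auto)
      then show ?thesis using x Cons by (intro exI[of _ x]) auto
    next
      case False
      then obtain j where j: "j \<in> I" "g j \<noteq> \<zero>" by auto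
      define J where "J = I - {j}"
      have J: "finite J" "I = insert j J" "j \<notin> J" using j 1(2) by (auto simp: J_def)
      define q where "q = inv (g j)"
      have q: "q \<in> carrier R" "q \<otimes> g j = \<one>" "g j \<otimes> q = \<one>"
        using j gc[of j] field_Units by (auto simp: q_def)
      define h' where "h' = (\<lambda>h i. h i \<ominus> (h j \<otimes> q) \<otimes> g i)"
      have h'c: "h' h i \<in> carrier R" if "h \<in> set hs" "i \<in> J" for h i
        using hc[of h] gc that q J by (auto simp: h'_def)
      have "length hs < card J" using 1(3) Cons J by simp
      then obtain x where x: "\<forall>i. x i \<in> carrier R" "\<exists>i\<in>J. x i \<noteq> \<zero>"
        "\<forall>h\<in>set hs. (\<Oplus>i\<in>J. x i \<otimes> h' h i) = \<zero>"
        using IH[of "map h' hs" J] Cons J(1) h'c by auto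
      define s where "s = (\<Oplus>i\<in>J. x i \<otimes> g i)"
      have s: "s \<in> carrier R" unfolding s_def by (rule finsum_closed) (use x gc J in auto)
      define y where "y = x(j := \<ominus> (s \<otimes> q))"
      have yc: "y i \<in> carrier R" for i using x s q by (auto simp: y_def)
      have split: "(\<Oplus>i\<in>I. y i \<otimes> k i) = \<ominus> (s \<otimes> q) \<otimes> k j \<oplus> (\<Oplus>i\<in>J. x i \<otimes> k i)"
        if "\<And>i. i \<in> I \<Longrightarrow> k i \<in> carrier R" for k
      proof -
        have "(\<Oplus>i\<in>J. y i \<otimes> k i) = (\<Oplus>i\<in>J. x i \<otimes> k i)"
          by (rule finsum_cong') (use J x that in \<open>auto simp: y_def\<close>)
        moreover have "y j = \<ominus> (s \<otimes> q)" by (simp add: y_def)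
        moreover have "(\<Oplus>i\<in>I. y i \<otimes> k i) = y j \<otimes> k j \<oplus> (\<Oplus>i\<in>J. y i \<otimes> k i)"
          unfolding J(2) by (rule finsum_insert) (use J yc that in auto)
        ultimately show ?thesis by simp
      qed
      have "(\<Oplus>i\<in>I. y i \<otimes> g i) = \<zero>"
      proof -
        have "\<ominus> (s \<otimes> q) \<otimes> g j \<oplus> s = \<zero>"
          using s q gc[OF j(1)] by (simp add: l_minus m_assoc l_neg)
        then show ?thesis using split[OF gc] by (simp add: s_def)
      qed
      moreover have "(\<Oplus>i\<in>I. y i \<otimes> h i) = \<zero>" if h: "h \<in> set hs" for h
      proof -
        define b where "b = h j \<otimes> q"
        have b: "b \<in> carrier R" using hc[OF h j(1)] q by (simp add: b_def)
        have t: "(\<Oplus>i\<in>J. x i \<otimes> h i) \<in> carrier R"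
          by (rule finsum_closed) (use x hc[OF h] J in auto)
        have "\<zero> = (\<Oplus>i\<in>J. x i \<otimes> h' h i)" using x h by auto
        also have "\<dots> = (\<Oplus>i\<in>J. x i \<otimes> h i \<oplus> (x i \<otimes> g i) \<otimes> (\<ominus> b))"
        proof (rule finsum_cong')
          fix i assume "i \<in> J"
          then have "x i \<in> carrier R" "h i \<in> carrier R" "g i \<in> carrier R"
            using x hc[OF h] gc J by auto
          then show "x i \<otimes> h' h i = x i \<otimes> h i \<oplus> (x i \<otimes> g i) \<otimes> (\<ominus> b)"
            unfolding h'_def b_def[symmetric] using b by algebra
        qed (use x hc[OF h] gc J b in auto)
        also have "\<dots> = (\<Oplus>i\<in>J. x i \<otimes> h i) \<oplus> (\<Oplus>i\<in>J. (x i \<otimes> g i) \<otimes> (\<ominus> b))"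
          by (rule finsum_addf) (use x hc[OF h] gc J b in auto)
        also have "(\<Oplus>i\<in>J. (x i \<otimes> g i) \<otimes> (\<ominus> b)) = s \<otimes> (\<ominus> b)"
          unfolding s_def by (rule finsum_ldistr[symmetric]) (use x gc J b in auto)
        finally have "\<zero> = (\<Oplus>i\<in>J. x i \<otimes> h i) \<oplus> s \<otimes> (\<ominus> b)" .
        moreover have "s \<otimes> (\<ominus> b) = \<ominus> (s \<otimes> q) \<otimes> h j"
          unfolding b_def using s q hc[OF h j(1)] by algebra
        ultimately show ?thesis
          using split[OF hc[OF h]] t s q hc[OF h j(1)] by (simp add: a_comm)
      qed
      moreover have "\<exists>i\<in>I. y i \<noteq> \<zero>" using x J by (auto simp: y_def)
      ultimately show ?thesis using yc Cons by (intro exI[of _ y]) auto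
    qed
  qed
qed

text \<open>The solutions are normalised against two unknowns \<open>k False\<close> and
  \<open>k True\<close>, from which the dual words of the next pair of functionals will be made. The
  second solution costs one more equation, hence \<open>Suc\<close>.\<close>

lemma homogeneous_system_two_solutions:
  assumes "finite I" "Suc (length gs) < card I" "\<And>g i. g \<in> set gs \<Longrightarrow> i \<in> I \<Longrightarrow> g i \<in> carrier R"
  shows "\<exists>x k. (\<forall>c i. x c i \<in> carrier R) \<and> (\<forall>c. k c \<in> I) \<and>
    (\<forall>c d. x c (k d) = (if c = (d::bool) then \<one> else \<zero>)) \<and>
    (\<forall>c. \<forall>g\<in>set gs. (\<Oplus>i\<in>I. x c i \<otimes> g i) = \<zero>)"
proof -
  have norm: "\<exists>y. (\<forall>i. y i \<in> carrier R) \<and> y k = \<one> \<and> (\<forall>i. x i = \<zero> \<longrightarrow> y i = \<zero>) \<and>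
      (\<forall>g\<in>set gs. (\<Oplus>i\<in>I. y i \<otimes> g i) = \<zero>)"
    if x: "\<forall>i. x i \<in> carrier R" "k \<in> I" "x k \<noteq> \<zero>" "\<forall>g\<in>set gs. (\<Oplus>i\<in>I. x i \<otimes> g i) = \<zero>" for x k
  proof -
    define q where "q = inv (x k)"
    have q: "q \<in> carrier R" "q \<otimes> x k = \<one>" using x field_Units by (auto simp: q_def)
    have "(\<Oplus>i\<in>I. q \<otimes> x i \<otimes> g i) = \<zero>" if g: "g \<in> set gs" for g
    proof -
      have "(\<Oplus>i\<in>I. q \<otimes> x i \<otimes> g i) = (\<Oplus>i\<in>I. q \<otimes> (x i \<otimes> g i))"
        by (rule finsum_cong') (use q x assms(3) g in \<open>auto simp: m_assoc\<close>)
      also have "\<dots> = q \<otimes> (\<Oplus>i\<in>I. x i \<otimes> g i)"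
        by (rule finsum_rdistr[symmetric]) (use q x assms g in auto)
      finally show ?thesis using x(4) g q by simp
    qed
    then show ?thesis using q x by (intro exI[of _ "\<lambda>i. q \<otimes> x i"]) auto
  qed
  have "\<exists>x. (\<forall>i. x i \<in> carrier R) \<and> (\<exists>i\<in>I. x i \<noteq> \<zero>) \<and>
      (\<forall>g\<in>set gs. (\<Oplus>i\<in>I. x i \<otimes> g i) = \<zero>)"
    by (rule homogeneous_system_solution) (use assms in auto)
  then obtain x0 i where x0: "\<forall>i. x0 i \<in> carrier R" "i \<in> I" "x0 i \<noteq> \<zero>"
    "\<forall>g\<in>set gs. (\<Oplus>i\<in>I. x0 i \<otimes> g i) = \<zero>"
    by blast
  obtain x where x: "\<forall>i. x i \<in> carrier R" "x i = \<one>" "\<forall>g\<in>set gs. (\<Oplus>i\<in>I. x i \<otimes> g i) = \<zero>"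
    using norm[OF x0] by blast
  \<comment> \<open>The additional equation makes the unknown \<open>i\<close> vanish in the second
    solution, which separates it from the first.\<close>
  define d where "d = (\<lambda>l. if l = i then \<one> else \<zero>)"
  have dc: "d l \<in> carrier R" for l by (auto simp: d_def)
  have "\<exists>y. (\<forall>i. y i \<in> carrier R) \<and> (\<exists>i\<in>I. y i \<noteq> \<zero>) \<and>
      (\<forall>g\<in>set (d # gs). (\<Oplus>i\<in>I. y i \<otimes> g i) = \<zero>)"
    by (rule homogeneous_system_solution) (use assms dc in auto)
  then obtain y0 j where y0: "\<forall>i. y0 i \<in> carrier R" "j \<in> I" "y0 j \<noteq> \<zero>"
    "\<forall>g\<in>set (d # gs). (\<Oplus>i\<in>I. y0 i \<otimes> g i) = \<zero>"
    by blast
  have "(\<Oplus>l\<in>I. y0 l \<otimes> d l) = (\<Oplus>l\<in>I. if i = l then y0 l else \<zero>)"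
    by (rule finsum_cong') (use y0 in \<open>auto simp: d_def\<close>)
  also have "\<dots> = y0 i"
    by (rule finsum_singleton) (use x0 assms y0 in auto)
  finally have y0i: "y0 i = \<zero>" using y0(4) by simp
  obtain y where y: "\<forall>i. y i \<in> carrier R" "y j = \<one>" "\<forall>i. y0 i = \<zero> \<longrightarrow> y i = \<zero>"
    "\<forall>g\<in>set gs. (\<Oplus>i\<in>I. y i \<otimes> g i) = \<zero>"
    using norm[of y0 j] y0 by auto
  have yi: "y i = \<zero>" using y y0i by simp
  \<comment> \<open>This clears the coordinate \<open>j\<close> of \<open>x\<close>; the coordinate
    \<open>i\<close> stays \<open>\<one>\<close> because \<open>y i\<close> is zero.\<close>
  define x' where "x' = (\<lambda>l. x l \<oplus> (\<ominus> x j) \<otimes> y l)"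
  have "(\<Oplus>i\<in>I. x' i \<otimes> g i) = \<zero>" if g: "g \<in> set gs" for g
  proof -
    have "(\<Oplus>i\<in>I. x' i \<otimes> g i) = (\<Oplus>i\<in>I. x i \<otimes> g i \<oplus> (\<ominus> x j) \<otimes> (y i \<otimes> g i))"
      by (rule finsum_cong') (use x y assms(3) g in \<open>auto simp: x'_def l_distr m_assoc\<close>)
    also have "\<dots> = (\<Oplus>i\<in>I. x i \<otimes> g i) \<oplus> (\<Oplus>i\<in>I. (\<ominus> x j) \<otimes> (y i \<otimes> g i))"
      by (rule finsum_addf) (use x y assms(3) g in auto)
    also have "(\<Oplus>i\<in>I. (\<ominus> x j) \<otimes> (y i \<otimes> g i)) = (\<ominus> x j) \<otimes> (\<Oplus>i\<in>I. y i \<otimes> g i)"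
      by (rule finsum_rdistr[symmetric]) (use x y assms g in auto)
    finally show ?thesis using x y g by simp
  qed
  moreover have "x' i = \<one>" "x' j = \<zero>" "\<forall>l. x' l \<in> carrier R"
    using x y yi by (auto simp: x'_def r_neg)
  ultimately show ?thesis
    using x0(2) y0(2) y yi
    by (intro exI[of _ "\<lambda>c. if c then x' else y"] exI[of _ "\<lambda>c. if c then i else j"]) auto
qed

end

section \<open>Block functionals\<close>

context ring
begin

primrec blk :: "nat \<Rightarrow> (bool \<Rightarrow> 'x list \<Rightarrow> 'a) \<Rightarrow> bool list \<Rightarrow> 'x list \<Rightarrow> 'a" where
  "blk N p [] = (\<lambda>y. if y = [] then \<one> else \<zero>)"
| "blk N p (c # z) = (\<lambda>y. p c (take N y) \<otimes> blk N p z (drop N y))"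

abbreviation word :: "(bool \<Rightarrow> 'x list) \<Rightarrow> bool list \<Rightarrow> 'x list" where
  "word w z \<equiv> concat (map w z)"

text \<open>The words \<open>w\<close> certify the linear independence of \<open>p False\<close> and
  \<open>p True\<close>. Carrying them along replaces later independence arguments by
  evaluations.\<close>

definition dual_pair :: "nat \<Rightarrow> (bool \<Rightarrow> 'x list \<Rightarrow> 'a) \<Rightarrow> (bool \<Rightarrow> 'x list) \<Rightarrow> bool" where
  "dual_pair N p w \<longleftrightarrow> 0 < N \<and> (\<forall>c y. p c y \<in> carrier R) \<and> (\<forall>c y. length y \<noteq> N \<longrightarrow> p c y = \<zero>) \<and>
     (\<forall>c. length (w c) = N) \<and> (\<forall>c d. p c (w d) = (if c = d then \<one> else \<zero>))"

lemma dual_pairD: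
  assumes "dual_pair N p w"
  shows "0 < N" "p c y \<in> carrier R" "length y \<noteq> N \<Longrightarrow> p c y = \<zero>" "length (w c) = N"
    "p c (w d) = (if c = d then \<one> else \<zero>)"
  using assms by (auto simp: dual_pair_def)

lemma blk_closed [simp]:
  assumes "\<And>c y. p c y \<in> carrier R"
  shows "blk N p z y \<in> carrier R"
  using assms by (induction z arbitrary: y) auto

lemma blk_support:
  assumes "\<And>c y. p c y \<in> carrier R" "\<And>c y. length y \<noteq> N \<Longrightarrow> p c y = \<zero>" "length y \<noteq> length z * N"
  shows "blk N p z y = \<zero>"
  using assms(3)
proof (induction z arbitrary: y)
  case (Cons c z)
  show ?case
  proof (cases "N \<le> length y")
    case True
    then have "blk N p z (drop N y) = \<zero>" using Cons.prems by (intro Cons.IH) auto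
    then show ?thesis using assms(1) by simp
  next
    case False
    then have "p c (take N y) = \<zero>" by (intro assms(2)) auto
    then show ?thesis using assms(1) by simp
  qed
qed auto

lemma length_word:
  assumes "\<And>c. length (w c) = N"
  shows "length (word w z) = length z * N"
  using assms by (induction z) auto

lemma blk_word:
  assumes "dual_pair N p w" "length z = length z'"
  shows "blk N p z (word w z') = (if z = z' then \<one> else \<zero>)"
  using assms(2)
proof (induction z z' rule: list_induct2)
  case (Cons c z d z')
  then show ?case using dual_pairD[OF assms(1)] by auto
qed auto

text \<open>
  \<open>A\<close> is the set of offsets at which an occurrence of \<open>f\<close> inside a word is annihilated.
\<close>

definition kills :: "nat set \<Rightarrow> ('a \<times> 'x list) list \<Rightarrow> ('x list \<Rightarrow> 'a) \<Rightarrow> bool" where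
  "kills A f \<phi> \<longleftrightarrow> (\<forall>u v. length u \<in> A \<longrightarrow> ev f (\<lambda>y. \<phi> (u @ y @ v)) = \<zero>)"

lemma kills_finsum:
  fixes G :: "'i \<Rightarrow> 'x list \<Rightarrow> 'a"
  assumes "coeffs_in f" "finite I" "\<And>i. i \<in> I \<Longrightarrow> x i \<in> carrier R"
    and "\<And>i y. i \<in> I \<Longrightarrow> G i y \<in> carrier R" "\<And>i. i \<in> I \<Longrightarrow> kills A f (G i)"
    and comm: "\<And>a b. a \<in> carrier R \<Longrightarrow> b \<in> carrier R \<Longrightarrow> a \<otimes> b = b \<otimes> a"
  shows "kills A f (\<lambda>y. \<Oplus>i\<in>I. x i \<otimes> G i y)"
  unfolding kills_def
proof (intro allI impI)
  fix u v :: "'x list" assume u: "length u \<in> A"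
  have "ev f (\<lambda>y. \<Oplus>i\<in>I. x i \<otimes> G i (u @ y @ v)) = (\<Oplus>i\<in>I. ev f (\<lambda>y. x i \<otimes> G i (u @ y @ v)))"
    by (rule ev_finsum) (use assms(1-4) in auto)
  also have "\<dots> = (\<Oplus>i\<in>I. \<zero>)"
  proof (rule finsum_cong')
    fix i assume i: "i \<in> I"
    have "ev f (\<lambda>y. x i \<otimes> G i (u @ y @ v)) = ev f (\<lambda>y. G i (u @ y @ v) \<otimes> x i)"
      by (rule ev_cong, rule comm) (use assms(3,4) i in auto)
    also have "\<dots> = ev f (\<lambda>y. G i (u @ y @ v)) \<otimes> x i"
      by (rule ev_mult_right) (use assms(1,3,4) i in auto)
    finally show "ev f (\<lambda>y. x i \<otimes> G i (u @ y @ v)) = \<zero>"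
      using assms(3,5) i u by (simp add: kills_def)
  qed auto
  finally show "ev f (\<lambda>y. \<Oplus>i\<in>I. x i \<otimes> G i (u @ y @ v)) = \<zero>"
    by simp
qed

end

context cring
begin

lemma ev_mult_left:
  assumes "coeffs_in r" "\<And>w. \<phi> w \<in> carrier R" "c \<in> carrier R"
  shows "ev r (\<lambda>w. c \<otimes> \<phi> w) = c \<otimes> ev r \<phi>"
  using ev_mult_right[of r \<phi> c] assms by (simp add: m_comm)

text \<open>By the conditions on \<open>A\<close> an admissible occurrence never straddles the cut
  at \<open>M\<close>, and one beyond the cut stays admissible when counted from there. So it lies
  in a single tensor factor.\<close>

lemma kills_tensor:
  fixes \<psi> :: "'x list \<Rightarrow> 'a"
  assumes "coeffs_in f" "\<And>y. y \<in> snd ` set f \<Longrightarrow> length y = L"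
    and "\<And>y. \<psi> y \<in> carrier R" "\<And>y. \<eta> y \<in> carrier R" "kills A f \<psi>" "kills A f \<eta>"
    and A: "\<And>a. a \<in> A \<Longrightarrow> a < M \<Longrightarrow> a + L \<le> M" "\<And>a. a \<in> A \<Longrightarrow> M \<le> a \<Longrightarrow> a - M \<in> A"
  shows "kills A f (\<lambda>y. \<psi> (take M y) \<otimes> \<eta> (drop M y))"
  unfolding kills_def
proof (intro allI impI)
  fix u v :: "'x list" assume u: "length u \<in> A"
  show "ev f (\<lambda>y. \<psi> (take M (u @ y @ v)) \<otimes> \<eta> (drop M (u @ y @ v))) = \<zero>"
  proof (cases "length u < M")
    case True
    then have le: "length u + L \<le> M" using A u by simp
    define v1 where "v1 = take (M - length u - L) v"
    define v2 where "v2 = drop (M - length u - L) v"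
    have "ev f (\<lambda>y. \<psi> (take M (u @ y @ v)) \<otimes> \<eta> (drop M (u @ y @ v))) =
        ev f (\<lambda>y. \<psi> (u @ y @ v1) \<otimes> \<eta> v2)"
    proof (rule ev_cong)
      fix y assume "y \<in> snd ` set f"
      then have "length y = L" by (rule assms(2))
      then have "take M (u @ y @ v) = u @ y @ v1" "drop M (u @ y @ v) = v2"
        using le by (auto simp: v1_def v2_def)
      then show "\<psi> (take M (u @ y @ v)) \<otimes> \<eta> (drop M (u @ y @ v)) = \<psi> (u @ y @ v1) \<otimes> \<eta> v2"
        by simp
    qed
    also have "\<dots> = ev f (\<lambda>y. \<psi> (u @ y @ v1)) \<otimes> \<eta> v2"
      by (rule ev_mult_right) (use assms in auto)
    finally show ?thesis using assms(4,5) u by (simp add: kills_def)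
  next
    case False
    have "ev f (\<lambda>y. \<psi> (take M (u @ y @ v)) \<otimes> \<eta> (drop M (u @ y @ v))) =
        ev f (\<lambda>y. \<psi> (take M u) \<otimes> \<eta> (drop M u @ y @ v))"
      using False by (intro ev_cong) auto
    also have "\<dots> = \<psi> (take M u) \<otimes> ev f (\<lambda>y. \<eta> (drop M u @ y @ v))"
      by (rule ev_mult_left) (use assms in auto)
    finally show ?thesis using assms(3,6) u A(2)[OF u] False by (simp add: kills_def)
  qed
qed

lemma kills_blk:
  fixes p :: "bool \<Rightarrow> 'x list \<Rightarrow> 'a"
  assumes "coeffs_in f" "\<And>y. y \<in> snd ` set f \<Longrightarrow> length y = L" "0 < L"
    and "\<And>c y. p c y \<in> carrier R" "\<And>c. kills A f (p c)"
    and A: "\<And>a. a \<in> A \<Longrightarrow> a < M \<Longrightarrow> a + L \<le> M" "\<And>a. a \<in> A \<Longrightarrow> M \<le> a \<Longrightarrow> a - M \<in> A"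
  shows "kills A f (blk M p z)"
proof (induction z)
  case Nil
  show ?case
    unfolding kills_def
  proof (intro allI impI ev_zero)
    fix u v y :: "'x list"
    assume "y \<in> snd ` set f"
    then have "y \<noteq> []" using assms(2,3) by force
    then show "blk M p [] (u @ y @ v) = \<zero>" by simp
  qed (rule assms(1))
next
  case (Cons c z)
  show ?case
    unfolding blk.simps by (rule kills_tensor[where L = L]) (use assms Cons in auto)
qed

text \<open>
  On every aligned block of length \<open>L\<close> the functional \<open>\<phi>\<close> acts through the two functionals
  \<open>p False\<close> and \<open>p True\<close>; expressing this with the dual words \<open>w\<close> makes it a linear condition on
  \<open>\<phi>\<close> that is inherited by sums and by tensor products.
\<close>

definition factors :: "nat \<Rightarrow> (bool \<Rightarrow> 'x list \<Rightarrow> 'a) \<Rightarrow> (bool \<Rightarrow> 'x list) \<Rightarrow> ('x list \<Rightarrow> 'a) \<Rightarrow> bool" where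
  "factors L p w \<phi> \<longleftrightarrow> (\<forall>y. length y = L \<longrightarrow>
     kills {a. L dvd a} [(\<one>, y), (\<ominus> p False y, w False), (\<ominus> p True y, w True)] \<phi>)"

lemma factorsD:
  assumes "factors L p w \<phi>" "\<And>y. \<phi> y \<in> carrier R" "\<And>c y. p c y \<in> carrier R"
    and "L dvd length u" "length y = L"
  shows "\<phi> (u @ y @ v) = p False y \<otimes> \<phi> (u @ w False @ v) \<oplus> p True y \<otimes> \<phi> (u @ w True @ v)"
proof -
  have "\<phi> (u @ y @ v) \<oplus> (\<ominus> p False y \<otimes> \<phi> (u @ w False @ v) \<oplus> \<ominus> p True y \<otimes> \<phi> (u @ w True @ v)) = \<zero>"
    using assms by (auto simp: factors_def kills_def)
  moreover have "\<phi> (u @ y @ v) \<in> carrier R" "\<phi> (u @ w False @ v) \<in> carrier R"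
    "\<phi> (u @ w True @ v) \<in> carrier R" "p False y \<in> carrier R" "p True y \<in> carrier R"
    using assms by auto
  ultimately have "\<phi> (u @ y @ v) \<ominus>
      (p False y \<otimes> \<phi> (u @ w False @ v) \<oplus> p True y \<otimes> \<phi> (u @ w True @ v)) = \<zero>"
    by (simp add: a_minus_def minus_add l_minus)
  then show ?thesis
    using assms(2,3) by simp
qed

text \<open>In a nonempty context every term vanishes by length; in the empty one the dual words
  leave \<open>p c y\<close> minus itself.\<close>

lemma factors_self:
  fixes p :: "bool \<Rightarrow> 'x list \<Rightarrow> 'a"
  assumes "dual_pair L p w"
  shows "factors L p w (p c)"
  unfolding factors_def kills_def
proof (intro allI impI)
  fix y u v :: "'x list"
  assume y: "length y = L"
  note d = dual_pairD[OF assms]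
  show "ev [(\<one>, y), (\<ominus> p False y, w False), (\<ominus> p True y, w True)] (\<lambda>y. p c (u @ y @ v)) = \<zero>"
  proof (cases "u = [] \<and> v = []")
    case True
    then show ?thesis
      using d(2)[of c y] by (cases c) (auto simp: d(2,5) r_neg)
  next
    case False
    then have "p c (u @ x @ v) = \<zero>" if "length x = L" for x
      using that by (intro d(3)) auto
    then show ?thesis using d y by simp
  qed
qed

lemma finite_length_eq_bool: "finite {z :: bool list. length z = l}"
  using finite_lists_length_eq[of "UNIV :: bool set" l] by simp

lemma finsum_length_Suc:
  assumes "\<And>z :: bool list. g z \<in> carrier R"
  shows "(\<Oplus>z\<in>{z. length z = Suc l}. g z) =
    (\<Oplus>z\<in>{z. length z = l}. g (False # z)) \<oplus> (\<Oplus>z\<in>{z. length z = l}. g (True # z))"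
proof -
  note fin = finite_length_eq_bool[of l]
  have eq: "{z. length z = Suc l} = (#) False ` {z. length z = l} \<union> (#) True ` {z. length z = l}"
  proof -
    have "z \<in> (#) False ` {z. length z = l} \<union> (#) True ` {z. length z = l}"
      if "length z = Suc l" for z :: "bool list"
      using that by (cases z; cases "hd z") auto
    then show ?thesis by auto
  qed
  have "(\<Oplus>z\<in>{z. length z = Suc l}. g z) =
      (\<Oplus>z\<in>(#) False ` {z. length z = l}. g z) \<oplus> (\<Oplus>z\<in>(#) True ` {z. length z = l}. g z)"
    unfolding eq by (rule finsum_Un_disjoint) (use fin assms in auto)
  also have "(\<Oplus>z\<in>(#) False ` {z. length z = l}. g z) = (\<Oplus>z\<in>{z. length z = l}. g (False # z))"
    by (rule finsum_reindex) (use assms in auto)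
  also have "(\<Oplus>z\<in>(#) True ` {z. length z = l}. g z) = (\<Oplus>z\<in>{z. length z = l}. g (True # z))"
    by (rule finsum_reindex) (use assms in auto)
  finally show ?thesis .
qed

text \<open>Iterating \<open>factorsD\<close> over consecutive blocks separates the dependence on
  \<open>y\<close> from the dependence on the context; the context enters only through the dual
  words.\<close>

lemma factors_expand:
  assumes "dual_pair L p w" "factors L p w \<phi>" "\<And>y. \<phi> y \<in> carrier R"
    and "L dvd length u" "length y = l * L"
  shows "\<phi> (u @ y @ v) = (\<Oplus>z\<in>{z. length z = l}. blk L p z y \<otimes> \<phi> (u @ word w z @ v))"
  using assms(4,5)
proof (induction l arbitrary: u y)
  case 0
  then show ?case using assms(3) by simp
next
  case (Suc l)
  note d = dual_pairD[OF assms(1)]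
  define y1 where "y1 = take L y"
  define y2 where "y2 = drop L y"
  have y: "y = y1 @ y2" "length y1 = L" "length y2 = l * L"
    using Suc.prems by (auto simp: y1_def y2_def)
  define S where "S = (\<lambda>c. \<Oplus>z\<in>{z. length z = l}. blk L p z y2 \<otimes> \<phi> (u @ w c @ word w z @ v))"
  have S: "\<phi> (u @ w c @ y2 @ v) = S c" for c
    using Suc.IH[of "u @ w c" y2] Suc.prems y d(4) by (simp add: S_def)
  have fs: "p c y1 \<otimes> S c = (\<Oplus>z\<in>{z. length z = l}. blk L p (c # z) y \<otimes> \<phi> (u @ word w (c # z) @ v))" for c
  proof -
    have "p c y1 \<otimes> S c = (\<Oplus>z\<in>{z. length z = l}. p c y1 \<otimes> (blk L p z y2 \<otimes> \<phi> (u @ w c @ word w z @ v)))"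
      unfolding S_def by (rule finsum_rdistr) (use finite_length_eq_bool assms(3) d(2) in auto)
    also have "\<dots> = (\<Oplus>z\<in>{z. length z = l}. blk L p (c # z) y \<otimes> \<phi> (u @ word w (c # z) @ v))"
      by (rule finsum_cong') (use assms(3) d(2) y in \<open>auto simp: m_assoc\<close>)
    finally show ?thesis .
  qed
  have "\<phi> (u @ y @ v) = p False y1 \<otimes> S False \<oplus> p True y1 \<otimes> S True"
    using factorsD[OF assms(2) assms(3) d(2) Suc.prems(1) y(2), of "y2 @ v"] S y by simp
  also have "\<dots> = (\<Oplus>z\<in>{z. length z = Suc l}. blk L p z y \<otimes> \<phi> (u @ word w z @ v))"
    unfolding fs by (rule finsum_length_Suc[symmetric]) (use assms(3) d(2) in auto)
  finally show ?case .
qed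

text \<open>
  A long power of \<open>a\<close> covers a whole aligned block. What it puts into that block is a partial
  factor, a power of \<open>a\<close> and another partial factor, and these are annihilated by \<open>p\<close>.
\<close>

lemma factors_ev_pow:
  assumes dp: "dual_pair L p w" and fac: "factors L p w \<phi>" and cl: "\<And>y. \<phi> y \<in> carrier R"
    and a: "coeffs_in a" "[] \<notin> snd ` set a" "\<And>y. y \<in> snd ` set a \<Longrightarrow> length y \<le> D" and "D \<le> L"
    and E: "\<And>c k w0 w1. length w0 \<le> D \<Longrightarrow> length w1 \<le> D \<Longrightarrow> ev (pow a k) (\<lambda>z. p c (w0 @ z @ w1)) = \<zero>"
    and m: "2 * L \<le> m"
  shows "ev (pow a m) (\<lambda>z. \<phi> (u @ z @ v)) = \<zero>"
proof -
  note d = dual_pairD[OF dp]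
  \<comment> \<open>The power starts in an aligned block, after a remnant \<open>w0\<close> of a
    word of \<open>a\<close>. Cutting where the block ends presents remnant, power and head to
    \<open>p\<close>, where \<open>E\<close> applies.\<close>
  have B: "ev (pow a m) (\<lambda>z. \<phi> (u0 @ w0 @ z @ v)) = \<zero>"
    if "L dvd length u0" "length w0 \<le> D" "L \<le> length w0 + m" for u0 w0 m
  proof -
    define n where "n = L - length w0"
    define g where "g = (\<lambda>y. \<phi> (u0 @ w0 @ y @ v))"
    define \<kappa> where "\<kappa> = (\<lambda>y y'. if length y = n then g (y @ y') else \<zero>)"
    have \<kappa>: "\<kappa> y y' = p False (w0 @ y) \<otimes> \<phi> (u0 @ w False @ y' @ v) \<oplus>
        p True (w0 @ y) \<otimes> \<phi> (u0 @ w True @ y' @ v)" for y y'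
    proof (cases "length y = n")
      case True
      then have "length (w0 @ y) = L" using that(2) \<open>D \<le> L\<close> by (simp add: n_def)
      from factorsD[OF fac cl d(2) that(1) this, of "y' @ v"] show ?thesis
        using True by (simp add: \<kappa>_def g_def)
    next
      case False
      then have "length (w0 @ y) \<noteq> L" using that(2) \<open>D \<le> L\<close> by (auto simp: n_def)
      then have "p c (w0 @ y) = \<zero>" for c by (rule d(3))
      then show ?thesis using False cl by (simp add: \<kappa>_def)
    qed
    have \<kappa>z: "ev (pow a k) (\<lambda>z. \<kappa> (z @ w1) y') = \<zero>" if w1: "length w1 \<le> D" for k w1 y'
    proof -
      have "ev (pow a k) (\<lambda>z. \<kappa> (z @ w1) y') =
          ev (pow a k) (\<lambda>z. p False (w0 @ z @ w1)) \<otimes> \<phi> (u0 @ w False @ y' @ v) \<oplus>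
          ev (pow a k) (\<lambda>z. p True (w0 @ z @ w1)) \<otimes> \<phi> (u0 @ w True @ y' @ v)"
        unfolding \<kappa> using a(1) cl d(2) by (simp add: ev_add ev_mult_right)
      then show ?thesis using E[OF \<open>length w0 \<le> D\<close> w1] cl by simp
    qed
    have "ev (pow a m) (conv \<kappa>) = \<zero>"
    proof (rule ev_pow_conv[OF a(1)])
      show "\<kappa> y y' \<in> carrier R" for y y' by (auto simp: \<kappa>_def g_def cl)
      show "ev (pow a k) (\<lambda>z. \<kappa> z y') = \<zero>" for k y' using \<kappa>z[of "[]" k y'] by simp
      show "ev (pow a k) (\<lambda>z. \<kappa> (z @ take e x) y') = \<zero>" if "x \<in> snd ` set a" for k x e y'
        using \<kappa>z[of "take e x" k y'] a(3)[OF that] by simp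
    qed
    moreover have "ev (pow a m) (conv \<kappa>) = ev (pow a m) g"
    proof (rule ev_cong)
      fix z assume "z \<in> snd ` set (pow a m)"
      then have "m \<le> length z" by (rule length_pow[OF a(2)])
      then show "conv \<kappa> z = g z"
        unfolding \<kappa>_def using that by (intro conv_single) (auto simp: n_def g_def cl)
    qed
    ultimately show ?thesis by (simp add: g_def)
  qed
  \<comment> \<open>Here \<open>\<alpha>\<close> numbers a block that the power covers entirely.
    Factors are moved into \<open>u\<close> until one reaches or crosses the boundary
    \<open>\<alpha> * L\<close>; the part beyond it is the remnant in \<open>B\<close>.\<close>
  have A: "ev (pow a m) (\<lambda>z. \<phi> (u @ z @ v)) = \<zero>"
    if "length u \<le> \<alpha> * L" "(\<alpha> + 1) * L \<le> length u + m" for u m \<alpha>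
    using that
  proof (induction m arbitrary: u)
    case 0
    then show ?case using d(1) by auto
  next
    case (Suc m)
    show ?case
    proof (cases "length u = \<alpha> * L")
      case True
      then show ?thesis using B[of u "[]" "Suc m"] Suc.prems by simp
    next
      case False
      have "ev (pow a (Suc m)) (\<lambda>z. \<phi> (u @ z @ v)) =
          ev a (\<lambda>x. ev (pow a m) (\<lambda>z. \<phi> ((u @ x) @ z @ v)))"
        using a(1) cl by (simp add: ev_mul)
      also have "\<dots> = \<zero>"
      proof (rule ev_zero[OF a(1)])
        fix x assume x: "x \<in> snd ` set a"
        then have lx: "1 \<le> length x" "length x \<le> D" using a(2,3) by (cases x; force)+
        show "ev (pow a m) (\<lambda>z. \<phi> ((u @ x) @ z @ v)) = \<zero>"
        proof (cases "length (u @ x) \<le> \<alpha> * L")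
          case True
          then show ?thesis using Suc.prems lx by (intro Suc.IH) auto
        next
          case gt: False
          define e where "e = \<alpha> * L - length u"
          have "ev (pow a m) (\<lambda>z. \<phi> ((u @ take e x) @ drop e x @ z @ v)) = \<zero>"
          proof (rule B)
            show "L dvd length (u @ take e x)"
              using gt Suc.prems by (auto simp: e_def min_def)
            show "length (drop e x) \<le> D" using lx by simp
            show "L \<le> length (drop e x) + m"
              using Suc.prems gt False lx by (auto simp: e_def)
          qed
          moreover have "(u @ take e x) @ drop e x @ z @ v = (u @ x) @ z @ v" for z
            by (metis append.assoc append_take_drop_id)
          ultimately show ?thesis by (simp only:)
        qed
      qed
      finally show ?thesis .
    qed
  qed
  \<comment> \<open>At most \<open>L\<close> letters lead to this boundary and \<open>L\<close> more
    fill the block, whence \<open>2 * L\<close>.\<close>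
  define \<alpha> where "\<alpha> = length u div L + 1"
  have "length u = length u div L * L + length u mod L" by simp
  moreover have "length u mod L < L" using d(1) by simp
  moreover have "\<alpha> * L = length u div L * L + L" by (simp add: \<alpha>_def)
  ultimately have "length u \<le> \<alpha> * L" "\<alpha> * L \<le> length u + L"
    by linarith+
  then show ?thesis using m by (intro A[of u \<alpha> m]) (auto simp: algebra_simps)
qed

end

section \<open>The algebra defined by a family of functionals\<close>

context ring
begin

text \<open>The free nonunital algebra on two letters. An element has many lists, which the quotient
  identifies; what counts is that the set of lists is countable.\<close>

definition elts :: "('a \<times> bool list) list set" where
  "elts = {r. coeffs_in r \<and> [] \<notin> snd ` set r}"

definition enum :: "nat \<Rightarrow> ('a \<times> bool list) list" where
  "enum = from_nat_into elts"

lemma elts_simps [simp]: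
  "[] \<in> elts"
  "x # r \<in> elts \<longleftrightarrow> fst x \<in> carrier R \<and> snd x \<noteq> [] \<and> r \<in> elts"
  "r @ s \<in> elts \<longleftrightarrow> r \<in> elts \<and> s \<in> elts"
  by (auto simp: elts_def)

lemma smul_elts [simp]: "c \<in> carrier R \<Longrightarrow> r \<in> elts \<Longrightarrow> smul c r \<in> elts"
  by (simp add: elts_def)

lemma mul_elts [simp]: "r \<in> elts \<Longrightarrow> s \<in> elts \<Longrightarrow> mul r s \<in> elts"
  by (auto simp: elts_def snd_set_mul)

lemma filter_elts [simp]: "r \<in> elts \<Longrightarrow> filter P r \<in> elts"
  by (auto simp: elts_def coeffs_in_def)

lemma elts_coeffs [simp]: "r \<in> elts \<Longrightarrow> coeffs_in r"
  by (simp add: elts_def)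

lemma elts_nonempty: "r \<in> elts \<Longrightarrow> [] \<notin> snd ` set r"
  unfolding elts_def by blast

lemma enum_elts [simp]: "enum n \<in> elts"
  unfolding enum_def by (rule from_nat_into) (use elts_simps(1) in blast)

lemma enum_surj:
  assumes "countable (carrier R)" "r \<in> elts"
  shows "\<exists>n. enum n = r"
proof -
  have "elts \<subseteq> lists (carrier R \<times> UNIV)"
    by (auto simp: elts_def coeffs_in_def)
  moreover have "countable (lists (carrier R \<times> (UNIV :: bool list set)))"
    using assms(1) by (intro countable_lists) auto
  ultimately have "countable elts"
    by (rule countable_subset)
  then show ?thesis
    unfolding enum_def using from_nat_into_surj assms(2) by metis
qed

lemma ev_filter:
  assumes "coeffs_in r" "\<And>w. \<phi> w \<in> carrier R"
  shows "ev r \<phi> = ev (filter P r) \<phi> \<oplus> ev (filter (\<lambda>x. \<not> P x) r) \<phi>"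
  using assms(1)
proof (induction r)
  case (Cons x r)
  moreover have "coeffs_in (filter Q r)" for Q
    using Cons.prems by (auto simp: coeffs_in_def)
  ultimately show ?case
    using assms(2) by (auto simp: a_ac)
qed simp

lemma ev_map: "ev (map (\<lambda>i. (x i, h i)) l) \<phi> = ev (map (\<lambda>i. (x i, i)) l) (\<lambda>i. \<phi> (h i))"
  by (induction l) auto

text \<open>An entry holds a coefficient, a datum ignored here, and a formal sum. The middle slot
  will hold the scalar part of an element of the unital hull.\<close>

definition lcomb :: "('a \<times> 'j \<times> ('a \<times> 'i) list) list \<Rightarrow> ('a \<times> 'i) list" where
  "lcomb xs = concat (map (\<lambda>x. smul (fst x) (snd (snd x))) xs)"

lemma lcomb_simps [simp]:
  "lcomb [] = []" "lcomb (x # xs) = smul (fst x) (snd (snd x)) @ lcomb xs"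
  by (auto simp: lcomb_def)

lemma lcomb_elts:
  assumes "coeffs_in xs" "\<And>x. x \<in> set xs \<Longrightarrow> snd (snd x) \<in> elts"
  shows "lcomb xs \<in> elts"
  using assms by (induction xs) auto

lemma ev_lcomb:
  assumes "coeffs_in xs" "\<And>x. x \<in> set xs \<Longrightarrow> coeffs_in (snd (snd x))" "\<And>w. \<phi> w \<in> carrier R"
  shows "ev (lcomb xs) \<phi> = ev xs (\<lambda>y. ev (snd y) \<phi>)"
  using assms(1,2)
proof (induction xs)
  case (Cons x xs)
  have "coeffs_in (lcomb xs)"
    using Cons.prems by (induction xs) auto
  then show ?case
    using Cons assms(3) by (simp add: ev_append ev_smul)
qed simp

end

context cring
begin

text \<open>Reconciles \<open>pow\<close>, which multiplies on the left, with
  \<open>pos_power\<close>, which multiplies on the right.\<close>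

lemma ev_pow_commute:
  assumes "coeffs_in a" "\<And>w. \<phi> w \<in> carrier R"
  shows "ev (mul (pow a n) a) \<phi> = ev (pow a (Suc n)) \<phi>"
  using assms(2)
proof (induction n arbitrary: \<phi>)
  case 0
  then show ?case using assms(1) by (simp add: ev_mul)
next
  case (Suc n)
  have "ev (mul (pow a (Suc n)) a) \<phi> = ev (mul a (mul (pow a n) a)) \<phi>"
    using assms(1) by (simp add: mul_assoc)
  also have "\<dots> = ev a (\<lambda>u. ev (mul (pow a n) a) (\<lambda>v. \<phi> (u @ v)))"
    using assms(1) Suc.prems by (intro ev_mul) auto
  also have "\<dots> = ev a (\<lambda>u. ev (pow a (Suc n)) (\<lambda>v. \<phi> (u @ v)))"
    using Suc by (simp del: pow.simps)
  also have "\<dots> = ev (pow a (Suc (Suc n))) \<phi>"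
    using assms(1) Suc.prems by (subst (2) pow.simps, intro ev_mul[symmetric]) auto
  finally show ?case .
qed

end

section \<open>The quotient algebra of a family of functionals\<close>

locale test_family = field R for R :: "('a, 'm) ring_scheme" (structure) +
  fixes \<Phi> :: "(bool list \<Rightarrow> 'a) set"
  assumes test_closed: "\<phi> \<in> \<Phi> \<Longrightarrow> \<phi> y \<in> carrier R"
    and countable_carrier: "countable (carrier R)"
begin

text \<open>
  The quotient is by the largest ideal on which all functionals of \<open>\<Phi>\<close> vanish; a class is
  represented by the least index of one of its elements.
\<close>

definition approx :: "('a \<times> bool list) list \<Rightarrow> ('a \<times> bool list) list \<Rightarrow> bool" where
  "approx r s \<longleftrightarrow> (\<forall>\<phi>\<in>\<Phi>. \<forall>u v. ev r (\<lambda>y. \<phi> (u @ y @ v)) = ev s (\<lambda>y. \<phi> (u @ y @ v)))"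

definition rep :: "('a \<times> bool list) list \<Rightarrow> nat" where
  "rep r = (LEAST n. approx (enum n) r)"

definition quot :: "('a, nat) module" where
  "quot = \<lparr>carrier = rep ` elts, mult = (\<lambda>m n. rep (mul (enum m) (enum n))), one = 0,
     zero = rep [], add = (\<lambda>m n. rep (enum m @ enum n)), smult = (\<lambda>c n. rep (smul c (enum n)))\<rparr>"

lemma approxI:
  assumes "\<And>\<phi>. (\<And>y. \<phi> y \<in> carrier R) \<Longrightarrow> ev r \<phi> = ev s \<phi>"
  shows "approx r s"
  unfolding approx_def by (auto intro!: assms test_closed)

lemma approx_sym: "approx r s \<Longrightarrow> approx s r"
  by (simp add: approx_def)

lemma approx_trans: "approx r s \<Longrightarrow> approx s t \<Longrightarrow> approx r t"
  by (simp add: approx_def)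

lemma approx_append: "\<lbrakk>approx r r'; approx s s'; r \<in> elts; r' \<in> elts; s \<in> elts; s' \<in> elts\<rbrakk> \<Longrightarrow> approx (r @ s) (r' @ s')"
  by (simp add: approx_def ev_append test_closed)

lemma approx_smul: "\<lbrakk>approx r r'; r \<in> elts; r' \<in> elts; c \<in> carrier R\<rbrakk> \<Longrightarrow> approx (smul c r) (smul c r')"
  by (simp add: approx_def ev_smul test_closed)

text \<open>One factor at a time is replaced while the other is absorbed into the context of the
  test; interchanging the evaluations brings each factor to the inside in turn.\<close>

lemma approx_mul:
  assumes "approx r r'" "approx s s'" "r \<in> elts" "r' \<in> elts" "s \<in> elts" "s' \<in> elts"
  shows "approx (mul r s) (mul r' s')"
  unfolding approx_def
proof (intro ballI allI)
  fix \<phi> u v assume \<phi>: "\<phi> \<in> \<Phi>"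
  note cl = test_closed[OF \<phi>]
  have "ev (mul r s) (\<lambda>y. \<phi> (u @ y @ v)) = ev r (\<lambda>x. ev s (\<lambda>y. \<phi> ((u @ x) @ y @ v)))"
    using assms cl by (simp add: ev_mul)
  also have "\<dots> = ev r (\<lambda>x. ev s' (\<lambda>y. \<phi> ((u @ x) @ y @ v)))"
  proof (rule ev_cong)
    show "ev s (\<lambda>y. \<phi> ((u @ x) @ y @ v)) = ev s' (\<lambda>y. \<phi> ((u @ x) @ y @ v))" for x
      using assms(2) \<phi> unfolding approx_def by blast
  qed
  also have "\<dots> = ev s' (\<lambda>y. ev r (\<lambda>x. \<phi> (u @ x @ (y @ v))))"
    by (subst ev_swap') (use assms cl in auto)
  also have "\<dots> = ev s' (\<lambda>y. ev r' (\<lambda>x. \<phi> (u @ x @ (y @ v))))"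
    using assms(1) \<phi> by (simp add: approx_def)
  also have "\<dots> = ev r' (\<lambda>x. ev s' (\<lambda>y. \<phi> (u @ x @ (y @ v))))"
    by (subst ev_swap') (use assms cl in auto)
  also have "\<dots> = ev (mul r' s') (\<lambda>y. \<phi> (u @ y @ v))"
    using assms cl by (simp add: ev_mul)
  finally show "ev (mul r s) (\<lambda>y. \<phi> (u @ y @ v)) = ev (mul r' s') (\<lambda>y. \<phi> (u @ y @ v))" .
qed

lemma approx_enum_rep:
  assumes "r \<in> elts"
  shows "approx (enum (rep r)) r"
proof -
  obtain n where "enum n = r" using enum_surj countable_carrier assms by blast
  then have "approx (enum n) r" by (simp add: approx_def)
  then show ?thesis unfolding rep_def by (rule LeastI)
qed

lemma rep_eq_iff:
  assumes "r \<in> elts" "s \<in> elts"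
  shows "rep r = rep s \<longleftrightarrow> approx r s"
proof
  assume "rep r = rep s"
  then show "approx r s"
    using approx_enum_rep[OF assms(1)] approx_enum_rep[OF assms(2)] approx_sym approx_trans by metis
next
  assume "approx r s"
  then have "approx x r = approx x s" for x
    using approx_sym approx_trans by blast
  then show "rep r = rep s" by (simp add: rep_def)
qed

lemma quot_carrier: "carrier quot = rep ` elts"
  by (simp add: quot_def)

lemma rep_carrier [simp]: "r \<in> elts \<Longrightarrow> rep r \<in> carrier quot"
  by (simp add: quot_carrier)

lemma quot_zero: "\<zero>\<^bsub>quot\<^esub> = rep []"
  by (simp add: quot_def)

lemma quot_add [simp]:
  assumes "r \<in> elts" "s \<in> elts"
  shows "rep r \<oplus>\<^bsub>quot\<^esub> rep s = rep (r @ s)"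
  using assms by (simp add: quot_def rep_eq_iff approx_append approx_enum_rep)

lemma quot_mult [simp]:
  assumes "r \<in> elts" "s \<in> elts"
  shows "rep r \<otimes>\<^bsub>quot\<^esub> rep s = rep (mul r s)"
  using assms by (simp add: quot_def rep_eq_iff approx_mul approx_enum_rep)

lemma quot_smult [simp]:
  assumes "c \<in> carrier R" "r \<in> elts"
  shows "c \<odot>\<^bsub>quot\<^esub> rep r = rep (smul c r)"
  using assms by (simp add: quot_def rep_eq_iff approx_smul approx_enum_rep)

lemma rep_cong:
  assumes "r \<in> elts" "s \<in> elts" "\<And>\<phi>. (\<And>y. \<phi> y \<in> carrier R) \<Longrightarrow> ev r \<phi> = ev s \<phi>"
  shows "rep r = rep s"
  using assms approxI by (simp add: rep_eq_iff)

lemma abelian_group_quot: "abelian_group quot"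
proof (rule abelian_groupI)
  fix x assume "x \<in> carrier quot"
  then obtain r where r: "x = rep r" "r \<in> elts" by (auto simp: quot_carrier)
  have "rep (smul (\<ominus> \<one>) r @ r) = rep []"
    by (rule rep_cong) (use r in \<open>auto simp: ev_append ev_smul l_minus l_neg\<close>)
  then show "\<exists>y\<in>carrier quot. y \<oplus>\<^bsub>quot\<^esub> x = \<zero>\<^bsub>quot\<^esub>"
    using r by (intro bexI[of _ "rep (smul (\<ominus> \<one>) r)"]) (auto simp: quot_zero)
  show "\<zero>\<^bsub>quot\<^esub> \<oplus>\<^bsub>quot\<^esub> x = x"
    using r by (simp add: quot_zero)
next
  fix x y assume "x \<in> carrier quot" "y \<in> carrier quot"
  then obtain r s where r: "x = rep r" "r \<in> elts" "y = rep s" "s \<in> elts" by (auto simp: quot_carrier)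
  have "rep (r @ s) = rep (s @ r)"
    by (rule rep_cong) (use r in \<open>auto simp: ev_append a_comm\<close>)
  then show "x \<oplus>\<^bsub>quot\<^esub> y = y \<oplus>\<^bsub>quot\<^esub> x"
    using r by simp
qed (auto simp: quot_carrier quot_zero)

lemma module_quot: "module R quot"
proof (rule moduleI)
  show "cring R" by (rule is_cring)
  show "abelian_group quot" by (rule abelian_group_quot)
  fix a b x y assume ab: "a \<in> carrier R" "b \<in> carrier R" and "x \<in> carrier quot" "y \<in> carrier quot"
  then obtain r s where r: "x = rep r" "r \<in> elts" "y = rep s" "s \<in> elts" by (auto simp: quot_carrier)
  have "rep (smul (a \<oplus> b) r) = rep (smul a r @ smul b r)"
    by (rule rep_cong) (use r ab in \<open>auto simp: ev_append ev_smul l_distr\<close>)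
  then show "(a \<oplus> b) \<odot>\<^bsub>quot\<^esub> x = a \<odot>\<^bsub>quot\<^esub> x \<oplus>\<^bsub>quot\<^esub> b \<odot>\<^bsub>quot\<^esub> x"
    using r ab by simp
  have "rep (smul a (r @ s)) = rep (smul a r @ smul a s)"
    by (rule rep_cong) (use r ab in \<open>auto simp: ev_append ev_smul r_distr\<close>)
  then show "a \<odot>\<^bsub>quot\<^esub> (x \<oplus>\<^bsub>quot\<^esub> y) = a \<odot>\<^bsub>quot\<^esub> x \<oplus>\<^bsub>quot\<^esub> a \<odot>\<^bsub>quot\<^esub> y"
    using r ab by simp
  have "rep (smul (a \<otimes> b) r) = rep (smul a (smul b r))"
    by (rule rep_cong) (use r ab in \<open>auto simp: ev_smul m_assoc\<close>)
  then show "(a \<otimes> b) \<odot>\<^bsub>quot\<^esub> x = a \<odot>\<^bsub>quot\<^esub> (b \<odot>\<^bsub>quot\<^esub> x)"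
    using r ab by simp
next
  fix x assume "x \<in> carrier quot"
  then obtain r where r: "x = rep r" "r \<in> elts" by (auto simp: quot_carrier)
  have "rep (smul \<one> r) = rep r"
    by (rule rep_cong) (use r in \<open>auto simp: ev_smul\<close>)
  then show "\<one> \<odot>\<^bsub>quot\<^esub> x = x"
    using r by simp
qed (auto simp: quot_carrier)

lemma assoc_algebra_quot: "assoc_algebra R quot"
proof (intro assoc_algebra.intro module_quot field_axioms assoc_algebra_axioms.intro)
  fix c x y z assume c: "c \<in> carrier R" "x \<in> carrier quot" "y \<in> carrier quot"
  then obtain r s where r: "x = rep r" "r \<in> elts" "y = rep s" "s \<in> elts"
    by (auto simp: quot_carrier)
  have "rep (mul (smul c r) s) = rep (smul c (mul r s))"
    by (rule rep_cong) (use r c in \<open>auto simp: ev_mul ev_smul\<close>)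
  then show "c \<odot>\<^bsub>quot\<^esub> x \<otimes>\<^bsub>quot\<^esub> y = c \<odot>\<^bsub>quot\<^esub> (x \<otimes>\<^bsub>quot\<^esub> y)"
    using r c by simp
  have "rep (mul r (smul c s)) = rep (smul c (mul r s))"
    by (rule rep_cong) (use r c in \<open>auto simp: ev_mul ev_smul ev_mult_left\<close>)
  then show "x \<otimes>\<^bsub>quot\<^esub> (c \<odot>\<^bsub>quot\<^esub> y) = c \<odot>\<^bsub>quot\<^esub> (x \<otimes>\<^bsub>quot\<^esub> y)"
    using r c by simp
next
  fix x y z assume c: "x \<in> carrier quot" "y \<in> carrier quot" "z \<in> carrier quot"
  then obtain r s t where r: "x = rep r" "r \<in> elts" "y = rep s" "s \<in> elts" "z = rep t" "t \<in> elts"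
    by (auto simp: quot_carrier)
  show "x \<otimes>\<^bsub>quot\<^esub> y \<otimes>\<^bsub>quot\<^esub> z = x \<otimes>\<^bsub>quot\<^esub> (y \<otimes>\<^bsub>quot\<^esub> z)"
    using r by (simp add: mul_assoc)
  have "rep (mul (r @ s) t) = rep (mul r t @ mul s t)"
    by (rule rep_cong) (use r in \<open>auto simp: ev_mul ev_append\<close>)
  then show "(x \<oplus>\<^bsub>quot\<^esub> y) \<otimes>\<^bsub>quot\<^esub> z = x \<otimes>\<^bsub>quot\<^esub> z \<oplus>\<^bsub>quot\<^esub> y \<otimes>\<^bsub>quot\<^esub> z"
    using r by simp
  have "rep (mul t (r @ s)) = rep (mul t r @ mul t s)"
    by (rule rep_cong) (use r in \<open>auto simp: ev_mul ev_append ev_add\<close>)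
  then show "z \<otimes>\<^bsub>quot\<^esub> (x \<oplus>\<^bsub>quot\<^esub> y) = z \<otimes>\<^bsub>quot\<^esub> x \<oplus>\<^bsub>quot\<^esub> z \<otimes>\<^bsub>quot\<^esub> y"
    using r by simp
qed (auto simp: quot_carrier)

end

sublocale test_family \<subseteq> A: assoc_algebra R quot
  by (rule assoc_algebra_quot)

sublocale test_family \<subseteq> U: ring "unital_hull R quot"
  by (rule A.ring_unital_hull)

context test_family
begin

section \<open>Nilness and the absence of an identity\<close>

lemma pow_elts:
  assumes "a \<in> elts"
  shows "pow a (Suc n) \<in> elts"
proof -
  have "w \<noteq> []" if "w \<in> snd ` set (pow a (Suc n))" for w
    using length_pow[OF _ that] assms by (auto simp: elts_def simp del: elts_coeffs)
  then have "[] \<notin> snd ` set (pow a (Suc n))"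
    by blast
  then show ?thesis
    using assms coeffs_in_pow[of a "Suc n"] by (simp add: elts_def del: pow.simps elts_coeffs coeffs_in_pow)
qed

lemma pos_power_quot:
  assumes "a \<in> elts"
  shows "pos_power quot (rep a) n = rep (pow a (Suc n))"
proof (induction n)
  case 0
  show ?case
    unfolding pos_power.simps
    by (rule rep_cong) (use assms pow_elts[of a 0] in \<open>auto simp: ev_mul\<close>)
next
  case (Suc n)
  have "rep (mul (pow a (Suc n)) a) = rep (pow a (Suc (Suc n)))"
    by (rule rep_cong) (use assms pow_elts[of a] ev_pow_commute[of a _ "Suc n"] in \<open>auto simp del: pow.simps\<close>)
  then show ?case
    using Suc assms pow_elts[of a n] by (simp del: pow.simps)
qed

lemma nil_algebra_quot:
  assumes "\<And>a. a \<in> elts \<Longrightarrow> \<exists>m. \<forall>\<phi>\<in>\<Phi>. \<forall>u v. ev (pow a (Suc m)) (\<lambda>y. \<phi> (u @ y @ v)) = \<zero>"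
  shows "nil_algebra quot"
  unfolding nil_algebra_def
proof
  fix x assume "x \<in> carrier quot"
  then obtain a where a: "x = rep a" "a \<in> elts" by (auto simp: quot_carrier)
  then obtain m where "approx (pow a (Suc m)) []"
    using assms[OF a(2)] by (auto simp: approx_def simp del: pow.simps)
  then have "pos_power quot x m = \<zero>\<^bsub>quot\<^esub>"
    using a pow_elts[OF a(2)] by (simp add: pos_power_quot quot_zero rep_eq_iff del: pow.simps)
  then show "\<exists>n. pos_power quot x n = \<zero>\<^bsub>quot\<^esub>" by blast
qed

text \<open>An identity equals all its powers, so nilness makes it zero and the whole algebra zero,
  against one nonzero test value. This selects the unital-hull branch of
  \<open>growth\<close>.\<close>

lemma no_identity:
  assumes "nil_algebra quot" "\<phi> \<in> \<Phi>" "y \<noteq> []" "\<phi> y \<noteq> \<zero>"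
  shows "\<not> is_identity quot e"
proof
  assume e: "is_identity quot e"
  then have ec: "e \<in> carrier quot" by (simp add: is_identity_def)
  have "pos_power quot e n = e" for n
    using e ec by (induction n) (auto simp: is_identity_def)
  then have e0: "e = \<zero>\<^bsub>quot\<^esub>"
    using assms(1) ec by (force simp: nil_algebra_def)
  have y: "[(\<one>, y)] \<in> elts" using assms(3) by simp
  then have "rep [(\<one>, y)] = e \<otimes>\<^bsub>quot\<^esub> rep [(\<one>, y)]"
    using e rep_carrier by (simp add: is_identity_def)
  also have "\<dots> = rep []"
    using e0 y rep_carrier by (simp add: quot_zero)
  finally have "approx [(\<one>, y)] []"
    using y by (simp add: rep_eq_iff)
  then have "ev [(\<one>, y)] (\<lambda>x. \<phi> ([] @ x @ [])) = ev [] (\<lambda>x. \<phi> ([] @ x @ []))"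
    unfolding approx_def using assms(2) by blast
  then show False
    using assms(4) test_closed[OF assms(2)] by simp
qed

end

section \<open>Growth of the algebra\<close>

context test_family
begin

section \<open>The filtration by word length\<close>

definition letter_space :: "nat set" where
  "letter_space = (\<lambda>W. submodule W R quot) hull {rep [(\<one>, [False])], rep [(\<one>, [True])]}"

definition elts_eq :: "nat \<Rightarrow> ('a \<times> bool list) list set" where
  "elts_eq n = {r \<in> elts. \<forall>w\<in>snd ` set r. length w = n}"

definition elts_le :: "nat \<Rightarrow> ('a \<times> bool list) list set" where
  "elts_le n = {r \<in> elts. \<forall>w\<in>snd ` set r. length w \<le> n}"

abbreviation "hull_ring \<equiv> unital_hull R quot"
abbreviation "scalars \<equiv> carrier R \<times> {\<zero>\<^bsub>quot\<^esub>}"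

lemma elts_eq_closed [simp]:
  "[] \<in> elts_eq n"
  "x # r \<in> elts_eq n \<longleftrightarrow> fst x \<in> carrier R \<and> snd x \<noteq> [] \<and> length (snd x) = n \<and> r \<in> elts_eq n"
  "r @ s \<in> elts_eq n \<longleftrightarrow> r \<in> elts_eq n \<and> s \<in> elts_eq n"
  "c \<in> carrier R \<Longrightarrow> r \<in> elts_eq n \<Longrightarrow> smul c r \<in> elts_eq n"
  "r \<in> elts_eq n \<Longrightarrow> s \<in> elts_eq m \<Longrightarrow> mul r s \<in> elts_eq (n + m)"
  unfolding elts_eq_def mem_Collect_eq snd_set_smul snd_set_mul by auto

lemma elts_le_closed [simp]:
  "[] \<in> elts_le n"
  "x # r \<in> elts_le n \<longleftrightarrow> fst x \<in> carrier R \<and> snd x \<noteq> [] \<and> length (snd x) \<le> n \<and> r \<in> elts_le n"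
  "r @ s \<in> elts_le n \<longleftrightarrow> r \<in> elts_le n \<and> s \<in> elts_le n"
  "c \<in> carrier R \<Longrightarrow> r \<in> elts_le n \<Longrightarrow> smul c r \<in> elts_le n"
  unfolding elts_le_def mem_Collect_eq snd_set_smul by auto

lemma elts_filter:
  assumes "r \<in> elts_le (Suc n)"
  shows "filter (\<lambda>y. length (snd y) \<le> n) r \<in> elts_le n"
    and "filter (\<lambda>y. \<not> length (snd y) \<le> n) r \<in> elts_eq (Suc n)"
  using assms by (induction r) auto

lemma elts_eq_imp_le: "r \<in> elts_eq n \<Longrightarrow> r \<in> elts_le n"
  by (induction r) auto

lemma elts_le_Suc: "r \<in> elts_le n \<Longrightarrow> r \<in> elts_le (Suc n)"
  by (induction r) auto

lemma elts_eq_elts [simp]: "r \<in> elts_eq n \<Longrightarrow> r \<in> elts"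
  by (simp add: elts_eq_def)

lemma elts_le_elts [simp]: "r \<in> elts_le n \<Longrightarrow> r \<in> elts"
  by (simp add: elts_le_def)

lemma hull_simps [simp]:
  "(a, x) \<otimes>\<^bsub>hull_ring\<^esub> (b, y) =
     (a \<otimes> b, a \<odot>\<^bsub>quot\<^esub> y \<oplus>\<^bsub>quot\<^esub> b \<odot>\<^bsub>quot\<^esub> x \<oplus>\<^bsub>quot\<^esub> x \<otimes>\<^bsub>quot\<^esub> y)"
  "(a, x) \<oplus>\<^bsub>hull_ring\<^esub> (b, y) = (a \<oplus> b, x \<oplus>\<^bsub>quot\<^esub> y)"
  "\<zero>\<^bsub>hull_ring\<^esub> = (\<zero>, \<zero>\<^bsub>quot\<^esub>)" "\<one>\<^bsub>hull_ring\<^esub> = (\<one>, \<zero>\<^bsub>quot\<^esub>)"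
  "carrier hull_ring = carrier R \<times> carrier quot"
  by (simp_all add: unital_hull_def)

lemma a_inv_rep:
  assumes "r \<in> elts"
  shows "\<ominus>\<^bsub>quot\<^esub> rep r = rep (smul (\<ominus> \<one>) r)"
proof (rule A.M.minus_equality)
  have "rep (smul (\<ominus> \<one>) r @ r) = rep []"
    by (rule rep_cong) (use assms in \<open>auto simp: ev_append ev_smul l_minus l_neg\<close>)
  then show "rep (smul (\<ominus> \<one>) r) \<oplus>\<^bsub>quot\<^esub> rep r = \<zero>\<^bsub>quot\<^esub>"
    using assms by (simp add: quot_zero)
qed (use assms in auto)

lemma submodule_rep_image:
  assumes "S \<subseteq> elts" "[] \<in> S" "\<And>r s. r \<in> S \<Longrightarrow> s \<in> S \<Longrightarrow> r @ s \<in> S"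
    and "\<And>c r. c \<in> carrier R \<Longrightarrow> r \<in> S \<Longrightarrow> smul c r \<in> S"
  shows "submodule (rep ` S) R quot"
proof (rule A.submoduleI)
  show "rep ` S \<subseteq> carrier quot" using assms(1) by auto
  show "\<zero>\<^bsub>quot\<^esub> \<in> rep ` S" using assms(2) by (simp add: quot_zero)
  fix x assume "x \<in> rep ` S"
  then obtain r where r: "x = rep r" "r \<in> S" "r \<in> elts" using assms(1) by auto
  then show "\<ominus>\<^bsub>quot\<^esub> x \<in> rep ` S" using assms(4) by (simp add: a_inv_rep)
  show "c \<odot>\<^bsub>quot\<^esub> x \<in> rep ` S" if "c \<in> carrier R" for c
    using r that assms(4) by simp
  fix y assume "y \<in> rep ` S"
  then obtain s where s: "y = rep s" "s \<in> S" "s \<in> elts" using assms(1) by auto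
  then show "x \<oplus>\<^bsub>quot\<^esub> y \<in> rep ` S" using r assms(3) by simp
qed

lemma rep_Cons:
  assumes "x # r \<in> elts"
  shows "rep (x # r) = fst x \<odot>\<^bsub>quot\<^esub> rep [(\<one>, snd x)] \<oplus>\<^bsub>quot\<^esub> rep r"
  using assms by (simp add: smul_def)

lemma letter_space_eq: "letter_space = rep ` elts_eq 1"
proof
  have "submodule (rep ` elts_eq 1) R quot"
    by (rule submodule_rep_image) auto
  moreover have "{rep [(\<one>, [False])], rep [(\<one>, [True])]} \<subseteq> rep ` elts_eq 1"
    by auto
  ultimately show "letter_space \<subseteq> rep ` elts_eq 1"
    unfolding letter_space_def by (intro hull_minimal)
next
  show "rep ` elts_eq 1 \<subseteq> letter_space"
    unfolding letter_space_def hull_def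
  proof (intro subsetI InterI)
    fix x W
    assume "x \<in> rep ` elts_eq 1"
      and "W \<in> {W. submodule W R quot \<and> {rep [(\<one>, [False])], rep [(\<one>, [True])]} \<subseteq> W}"
    then obtain r where r: "x = rep r" "r \<in> elts_eq 1"
      and W: "submodule W R quot" "rep [(\<one>, [b])] \<in> W" for b
      by (auto, metis (full_types))
    interpret W: submodule W R quot by (rule W(1))
    have "rep r \<in> W" using r(2)
    proof (induction r)
      case Nil
      show ?case using W.one_closed by (simp add: quot_zero)
    next
      case (Cons x r)
      then have r: "r \<in> elts_eq 1" "x # r \<in> elts" "length (snd x) = 1"
        by auto
      then obtain b where b: "snd x = [b]" by (auto simp: length_Suc_conv)
      then have "fst x \<odot>\<^bsub>quot\<^esub> rep [(\<one>, snd x)] \<in> W"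
        using r W(2)[of b] by (intro W.smult_closed) auto
      then show ?case
        unfolding rep_Cons[OF r(2)] using Cons.IH[OF r(1)] A.submoduleE(5)[OF W(1)] by blast
    qed
    then show "x \<in> W" by (simp add: r)
  qed
qed

lemma generating_letter_space: "generating_subspace R quot letter_space"
proof -
  have "finite_dim_subspace R quot letter_space"
    unfolding finite_dim_subspace_def letter_space_def
    by (intro exI[of _ "{rep [(\<one>, [False])], rep [(\<one>, [True])]}"]) auto
  moreover have "nonunital_subalgebra R quot hull letter_space = carrier quot"
  proof
    show "nonunital_subalgebra R quot hull letter_space \<subseteq> carrier quot"
    proof (rule hull_minimal)
      show "letter_space \<subseteq> carrier quot" by (auto simp: letter_space_eq)
      show "nonunital_subalgebra R quot (carrier quot)"
        unfolding nonunital_subalgebra_def using A.carrier_is_submodule A.mult_closed by blast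
    qed
    show "carrier quot \<subseteq> nonunital_subalgebra R quot hull letter_space"
      unfolding hull_def
    proof (intro subsetI InterI)
      fix x W
      assume "x \<in> carrier quot" and "W \<in> {W. nonunital_subalgebra R quot W \<and> letter_space \<subseteq> W}"
      then obtain r where r: "x = rep r" "r \<in> elts"
        and W: "submodule W R quot" "\<And>x y. x \<in> W \<Longrightarrow> y \<in> W \<Longrightarrow> x \<otimes>\<^bsub>quot\<^esub> y \<in> W" "letter_space \<subseteq> W"
        by (auto simp: nonunital_subalgebra_def quot_carrier)
      interpret W: submodule W R quot by (rule W(1))
      have letter: "rep [(\<one>, [b])] \<in> W" for b
        using W(3) unfolding letter_space_eq by auto
      have word: "rep [(\<one>, w)] \<in> W" if "w \<noteq> []" for w
        using that
      proof (induction w)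
        case (Cons b w)
        show ?case
        proof (cases "w = []")
          case False
          then have "rep [(\<one>, [b])] \<otimes>\<^bsub>quot\<^esub> rep [(\<one>, w)] \<in> W"
            using Cons letter W(2) by blast
          then show ?thesis using False by (simp add: mul_def)
        qed (use letter in simp)
      qed simp
      have "rep r \<in> W" using r(2)
      proof (induction r)
        case Nil
        show ?case using W.one_closed by (simp add: quot_zero)
      next
        case (Cons x r)
        then have "fst x \<odot>\<^bsub>quot\<^esub> rep [(\<one>, snd x)] \<in> W"
          using word by (intro W.smult_closed) auto
        moreover have "rep r \<in> W" using Cons by simp
        ultimately show ?case
          unfolding rep_Cons[OF Cons.prems] by (rule A.submoduleE(5)[OF W(1)])
      qed
      then show "x \<in> W" by (simp add: r)
    qed
  qed
  ultimately show ?thesis by (simp add: generating_subspace_def)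
qed

lemma smul_Nil [simp]: "smul c [] = []"
  by (simp add: smul_def)

lemma scalar_mult:
  assumes "c \<in> carrier R" "a \<in> carrier R" "r \<in> elts"
  shows "(c, \<zero>\<^bsub>quot\<^esub>) \<otimes>\<^bsub>hull_ring\<^esub> (a, rep r) = (c \<otimes> a, rep (smul c r))"
  using assms by (simp add: quot_zero)

lemma zero_mult_zero:
  assumes "r \<in> elts" "s \<in> elts"
  shows "(\<zero>, rep r) \<otimes>\<^bsub>hull_ring\<^esub> (\<zero>, rep s) = (\<zero>, rep (mul r s))"
proof -
  have "\<zero> \<odot>\<^bsub>quot\<^esub> rep t = \<zero>\<^bsub>quot\<^esub>" if "t \<in> elts" for t
    using that by (intro A.smult_l_null) auto
  then show ?thesis using assms A.M.l_zero by (simp del: quot_smult)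
qed

text \<open>Stated from exponent one on, since the power with exponent zero is the field of scalars.
  In the induction a word splits off its last letter.\<close>

lemma space_power_eq:
  "space_power hull_ring scalars ({\<zero>} \<times> letter_space) (Suc n) = Pair \<zero> ` rep ` elts_eq (Suc n)"
proof (induction n)
  case 0
  show ?case (is "?L = ?R")
  proof
    show "?L \<subseteq> ?R"
    proof
      fix x assume "x \<in> ?L"
      then show "x \<in> ?R"
        unfolding space_power.simps letter_space_eq
      proof (induction x rule: ideal_prod.induct)
        case (prod i j)
        then obtain c s where "i = (c, \<zero>\<^bsub>quot\<^esub>)" "c \<in> carrier R" "j = (\<zero>, rep s)" "s \<in> elts_eq 1" by auto
        then show ?case using scalar_mult[of c \<zero> s] by (auto simp del: hull_simps)
      next
        case (sum x y)
        then obtain r s where "x = (\<zero>, rep r)" "r \<in> elts_eq 1" "y = (\<zero>, rep s)" "s \<in> elts_eq 1" by auto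
        then show ?case by auto
      qed
    qed
    show "?R \<subseteq> ?L"
    proof
      fix x assume "x \<in> ?R"
      then obtain r where r: "x = (\<zero>, rep r)" "r \<in> elts_eq 1" by auto
      have "(\<one>, \<zero>\<^bsub>quot\<^esub>) \<otimes>\<^bsub>hull_ring\<^esub> x = x"
        using U.l_one[of x] r by simp
      moreover have "(\<one>, \<zero>\<^bsub>quot\<^esub>) \<otimes>\<^bsub>hull_ring\<^esub> x \<in> ?L"
        unfolding space_power.simps letter_space_eq by (rule ideal_prod.prod) (use r in auto)
      ultimately show "x \<in> ?L" by (simp only:)
    qed
  qed
next
  case (Suc n)
  show ?case (is "?L = ?R")
    unfolding space_power.simps(2)[of _ _ _ "Suc n"] Suc
  proof
    let ?P = "ideal_prod hull_ring (Pair \<zero> ` rep ` elts_eq (Suc n)) ({\<zero>} \<times> letter_space)"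
    show "?P \<subseteq> ?R"
    proof
      fix x assume "x \<in> ?P"
      then show "x \<in> ?R"
        unfolding letter_space_eq
      proof (induction x rule: ideal_prod.induct)
        case (prod i j)
        then obtain r s where rs: "i = (\<zero>, rep r)" "r \<in> elts_eq (Suc n)" "j = (\<zero>, rep s)" "s \<in> elts_eq 1" by auto
        moreover have "mul r s \<in> elts_eq (Suc (Suc n))"
          using elts_eq_closed(5)[OF rs(2,4)] by simp
        ultimately show ?case using zero_mult_zero[of r s] by (auto simp del: hull_simps)
      next
        case (sum x y)
        then obtain r s where "x = (\<zero>, rep r)" "r \<in> elts_eq (Suc (Suc n))" "y = (\<zero>, rep s)" "s \<in> elts_eq (Suc (Suc n))" by auto
        then show ?case by auto
      qed
    qed
    have "(\<zero>, rep r) \<in> ?P" if "r \<in> elts_eq (Suc (Suc n))" for r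
      using that
    proof (induction r)
      case Nil
      have "(\<zero>, rep []) \<otimes>\<^bsub>hull_ring\<^esub> (\<zero>, rep []) \<in> ?P"
        unfolding letter_space_eq by (rule ideal_prod.prod) auto
      then show ?case using zero_mult_zero[of "[]" "[]"] by (simp del: hull_simps)
    next
      case (Cons x r)
      then have r: "r \<in> elts_eq (Suc (Suc n))" "x # r \<in> elts" "length (snd x) = Suc (Suc n)"
        by auto
      define u where "u = [(fst x, butlast (snd x))]"
      define v where "v = [(\<one>, [last (snd x)])]"
      have "snd x \<noteq> []" "butlast (snd x) \<noteq> []" using r(3) by (auto simp flip: length_greater_0_conv)
      then have uv: "mul u v = [x]" "u \<in> elts_eq (Suc n)" "v \<in> elts_eq 1"
        using r by (auto simp: mul_def u_def v_def)
      have "(\<zero>, rep u) \<otimes>\<^bsub>hull_ring\<^esub> (\<zero>, rep v) \<in> ?P"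
        unfolding letter_space_eq by (rule ideal_prod.prod) (use uv in auto)
      then have "(\<zero>, rep [x]) \<in> ?P"
        using zero_mult_zero[of u v] uv by (simp del: hull_simps)
      then have "(\<zero>, rep [x]) \<oplus>\<^bsub>hull_ring\<^esub> (\<zero>, rep r) \<in> ?P"
        using Cons.IH[OF r(1)] by (rule ideal_prod.sum)
      then show ?case using r(2) by simp
    qed
    then show "?R \<subseteq> ?P" by blast
  qed
qed

lemma space_filtration_eq:
  "space_filtration hull_ring scalars ({\<zero>} \<times> letter_space) n = carrier R \<times> rep ` elts_le n"
proof (induction n)
  case 0
  have "elts_le 0 = {[]}"
  proof -
    have "r = []" if "r \<in> elts_le 0" for r
      using that by (cases r) auto
    then show ?thesis by auto
  qed
  then show ?case by (simp add: quot_zero)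
next
  case (Suc n)
  have "carrier R \<times> rep ` elts_le n <+>\<^bsub>hull_ring\<^esub> Pair \<zero> ` rep ` elts_eq (Suc n) =
      carrier R \<times> rep ` elts_le (Suc n)" (is "?L = ?R")
  proof
    show "?L \<subseteq> ?R"
    proof
      fix x assume "x \<in> ?L"
      then obtain c r s where x: "c \<in> carrier R" "r \<in> elts_le n" "s \<in> elts_eq (Suc n)"
        "x = (c, rep r) \<oplus>\<^bsub>hull_ring\<^esub> (\<zero>, rep s)"
        unfolding set_add_def' by blast
      moreover have "r @ s \<in> elts_le (Suc n)" using x by (auto intro: elts_le_Suc elts_eq_imp_le)
      ultimately show "x \<in> ?R" by auto
    qed
    show "?R \<subseteq> ?L"
    proof
      fix x assume "x \<in> ?R"
      then obtain c r where x: "x = (c, rep r)" "c \<in> carrier R" "r \<in> elts_le (Suc n)" by auto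
      define r1 where "r1 = filter (\<lambda>y. length (snd y) \<le> n) r"
      define r2 where "r2 = filter (\<lambda>y. \<not> length (snd y) \<le> n) r"
      have "rep r = rep (r1 @ r2)"
        unfolding r1_def r2_def
        by (rule rep_cong) (use x filter_elts[of r] ev_filter[of r] in \<open>auto simp: ev_append\<close>)
      then have "x = (c, rep r1) \<oplus>\<^bsub>hull_ring\<^esub> (\<zero>, rep r2)"
        using x by (simp add: r1_def r2_def)
      moreover have "r1 \<in> elts_le n" "r2 \<in> elts_eq (Suc n)"
        using elts_filter[OF x(3)] by (auto simp: r1_def r2_def)
      ultimately show "x \<in> ?L" unfolding set_add_def' using x(2) by blast
    qed
  qed
  then show ?case by (simp only: space_filtration.simps space_power_eq Suc)
qed

lemma subfield_scalars: "subfield scalars hull_ring"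
  by (rule A.subfield_unital_hull)

text \<open>This makes \<open>ring.dim\<close> an actual dimension. The spanning list is the unit
  followed by the nonempty words of length at most \<open>n\<close>.\<close>

lemma finite_dimension_filtration:
  "ring.finite_dimension hull_ring scalars (carrier R \<times> rep ` elts_le n)"
proof -
  let ?E = "carrier R \<times> rep ` elts_le n"
  have "finite {w :: bool list. set w \<subseteq> UNIV \<and> length w \<le> n}"
    by (rule finite_lists_length_le) simp
  then obtain ws where ws: "set ws = {w :: bool list. length w \<le> n \<and> w \<noteq> []}"
    using finite_list[of "{w :: bool list. length w \<le> n \<and> w \<noteq> []}"]
    by (metis (no_types, lifting) finite_subset mem_Collect_eq subsetI subset_UNIV)
  define Us where "Us = (\<one>, \<zero>\<^bsub>quot\<^esub>) # map (\<lambda>w. (\<zero>, rep [(\<one>, w)])) ws"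
  have Us: "set Us \<subseteq> ?E"
    using ws by (auto simp: Us_def quot_zero)
  have smult: "k \<otimes>\<^bsub>hull_ring\<^esub> v \<in> ?E" if k: "k \<in> scalars" and v: "v \<in> ?E" for k v
  proof -
    obtain c where "k = (c, \<zero>\<^bsub>quot\<^esub>)" "c \<in> carrier R" using k by auto
    moreover obtain a r where "v = (a, rep r)" "a \<in> carrier R" "r \<in> elts_le n" using v by auto
    ultimately show ?thesis using scalar_mult[of c a r] by (auto simp del: hull_simps)
  qed
  have add: "x \<oplus>\<^bsub>hull_ring\<^esub> y \<in> ?E" if "x \<in> ?E" "y \<in> ?E" for x y
    using that by auto
  have carr: "?E \<subseteq> carrier hull_ring" by auto
  have "subgroup ?E (add_monoid hull_ring)"
  proof (rule U.add.subgroupI)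
    fix x assume x: "x \<in> ?E"
    have xc: "x \<in> carrier hull_ring" using x carr by blast
    have "\<ominus>\<^bsub>hull_ring\<^esub> x = (\<ominus>\<^bsub>hull_ring\<^esub> \<one>\<^bsub>hull_ring\<^esub>) \<otimes>\<^bsub>hull_ring\<^esub> x"
      using U.l_minus[OF U.one_closed xc] U.l_one[OF xc] by (simp only:)
    moreover have "\<ominus>\<^bsub>hull_ring\<^esub> \<one>\<^bsub>hull_ring\<^esub> \<in> scalars"
      by (rule U.subring_props(5)[OF subfield_scalars U.subring_props(3)[OF subfield_scalars]])
    ultimately show "\<ominus>\<^bsub>hull_ring\<^esub> x \<in> ?E" using smult[OF _ x] by (simp only:)
  qed (use carr add elts_le_closed(1)[of n] in \<open>auto simp del: elts_le_closed\<close>)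
  then have sub: "subalgebra scalars ?E hull_ring"
    by (intro subalgebra.intro subalgebra_axioms.intro smult)
  have "?E = U.Span scalars Us"
  proof (rule U.Span_subalgebraI[OF subfield_scalars sub Us])
    fix V assume V: "subalgebra scalars V hull_ring" "set Us \<subseteq> V"
    interpret V: subalgebra scalars V hull_ring by (rule V(1))
    have Vadd: "x \<oplus>\<^bsub>hull_ring\<^esub> y \<in> V" if "x \<in> V" "y \<in> V" for x y
      using V.m_closed that by simp
    have scal: "(c, \<zero>\<^bsub>quot\<^esub>) \<in> V" if "c \<in> carrier R" for c
    proof -
      have "(\<one>, rep []) \<in> V" using V(2) by (simp add: Us_def quot_zero)
      then have "(c, \<zero>\<^bsub>quot\<^esub>) \<otimes>\<^bsub>hull_ring\<^esub> (\<one>, rep []) \<in> V"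
        using that by (intro V.smult_closed) auto
      then show ?thesis
        using scalar_mult[of c \<one> "[]"] that by (simp add: smul_def quot_zero del: hull_simps)
    qed
    have "(\<zero>, rep r) \<in> V" if "r \<in> elts_le n" for r
      using that
    proof (induction r)
      case Nil
      show ?case using scal[of \<zero>] by (simp add: quot_zero)
    next
      case (Cons x r)
      then have r: "r \<in> elts_le n" "x # r \<in> elts" "length (snd x) \<le> n"
        by auto
      then have "(\<zero>, rep [(\<one>, snd x)]) \<in> V" using V(2) ws by (auto simp: Us_def)
      then have "(fst x, \<zero>\<^bsub>quot\<^esub>) \<otimes>\<^bsub>hull_ring\<^esub> (\<zero>, rep [(\<one>, snd x)]) \<in> V"
        using r by (intro V.smult_closed) auto
      then have "(\<zero>, rep [x]) \<in> V"
        using scalar_mult[of "fst x" \<zero> "[(\<one>, snd x)]"] r by (simp add: smul_def del: hull_simps)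
      then have "(\<zero>, rep [x]) \<oplus>\<^bsub>hull_ring\<^esub> (\<zero>, rep r) \<in> V"
        using Cons.IH[OF r(1)] by (rule Vadd)
      then show ?case using r(2) by simp
    qed
    then have "(c, \<zero>\<^bsub>quot\<^esub>) \<oplus>\<^bsub>hull_ring\<^esub> (\<zero>, rep r) \<in> V" if "r \<in> elts_le n" "c \<in> carrier R" for r c
      using that scal Vadd by blast
    then show "?E \<subseteq> V"
      by (auto simp: quot_zero)
  qed
  then show ?thesis
    using U.Span_finite_dimension[OF subfield_scalars, of Us] Us carr by auto
qed

text \<open>The bridge between linear combinations in the hull and evaluation of formal sums:
  \<open>xs\<close> packs coefficients, scalar parts and formal sums into one list.\<close>

lemma combine_hull:
  assumes "coeffs_in xs" "\<And>x. x \<in> set xs \<Longrightarrow> fst (snd x) \<in> carrier R \<and> snd (snd x) \<in> elts"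
  shows "U.combine (map (\<lambda>x. (fst x, \<zero>\<^bsub>quot\<^esub>)) xs) (map (\<lambda>x. (fst (snd x), rep (snd (snd x)))) xs) =
    (ev xs fst, rep (lcomb xs))"
  using assms
proof (induction xs)
  case Nil
  then show ?case by (simp add: quot_zero)
next
  case (Cons x xs)
  have "lcomb xs \<in> elts" using Cons.prems by (intro lcomb_elts) auto
  then show ?case
    using Cons scalar_mult[of "fst x" "fst (snd x)" "snd (snd x)"] by (simp del: hull_simps(1))
qed

text \<open>A basis longer than the number of conditions has a nontrivial combination satisfying all
  of them, and \<open>sep\<close> makes it zero. There is one condition per functional and one for
  the scalar part, hence \<open>Suc\<close>.\<close>

lemma dimension_filtration_le:
  assumes dim: "U.dimension d scalars (carrier R \<times> rep ` elts_le n)"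
    and \<Lambda>: "\<And>l y. l \<in> set \<Lambda> \<Longrightarrow> l y \<in> carrier R"
    and sep: "\<And>r. r \<in> elts_le n \<Longrightarrow> (\<And>l. l \<in> set \<Lambda> \<Longrightarrow> ev r l = \<zero>) \<Longrightarrow> approx r []"
  shows "d \<le> Suc (length \<Lambda>)"
proof (rule ccontr)
  assume "\<not> d \<le> Suc (length \<Lambda>)"
  then have d: "Suc (length \<Lambda>) < d" by simp
  obtain Us where Us: "set Us \<subseteq> carrier hull_ring" "U.independent scalars Us" "length Us = d"
    "U.Span scalars Us = carrier R \<times> rep ` elts_le n"
    using U.exists_base[OF subfield_scalars dim] by blast
  have "set Us \<subseteq> carrier R \<times> rep ` elts_le n"
    using U.Span_base_incl[OF subfield_scalars Us(1)] Us(4) by simp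
  then have "Us ! i \<in> carrier R \<times> rep ` elts_le n" if "i < d" for i
    using Us(3) nth_mem[of i Us] that by blast
  then have "\<forall>i<d. \<exists>c r. Us ! i = (c, rep r) \<and> c \<in> carrier R \<and> r \<in> elts_le n"
  proof (intro allI impI)
    fix i assume "i < d"
    then obtain c r where "Us ! i = (c, rep r)" "c \<in> carrier R" "r \<in> elts_le n"
      using \<open>\<And>i. i < d \<Longrightarrow> Us ! i \<in> carrier R \<times> rep ` elts_le n\<close>[of i] by blast
    then show "\<exists>c r. Us ! i = (c, rep r) \<and> c \<in> carrier R \<and> r \<in> elts_le n" by blast
  qed
  then obtain c r where cr: "\<And>i. i < d \<Longrightarrow> Us ! i = (c i, rep (r i))"
    "\<And>i. i < d \<Longrightarrow> c i \<in> carrier R" "\<And>i. i < d \<Longrightarrow> r i \<in> elts_le n"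
    by metis
  have re: "r i \<in> elts" if "i < d" for i
    using cr(3)[OF that] by (rule elts_le_elts)
  define gs where "gs = c # map (\<lambda>l i. ev (r i) l) \<Lambda>"
  have gc: "g i \<in> carrier R" if "g \<in> set gs" "i \<in> {..<d}" for g i
    using that cr(2) re \<Lambda> by (auto simp: gs_def)
  have "\<exists>x. (\<forall>i. x i \<in> carrier R) \<and> (\<exists>i\<in>{..<d}. x i \<noteq> \<zero>) \<and>
      (\<forall>g\<in>set gs. (\<Oplus>i\<in>{..<d}. x i \<otimes> g i) = \<zero>)"
    by (rule homogeneous_system_solution) (use d gc in \<open>auto simp: gs_def\<close>)
  then obtain x j where x: "\<forall>i. x i \<in> carrier R" "j < d" "x j \<noteq> \<zero>"
    "\<forall>g\<in>set gs. (\<Oplus>i\<in>{..<d}. x i \<otimes> g i) = \<zero>"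
    by auto
  define xs where "xs = map (\<lambda>i. (x i, (c i, r i))) [0..<d]"
  have xsum: "ev xs f = \<zero>" if "g \<in> set gs" "\<And>i. i < d \<Longrightarrow> f (c i, r i) = g i" for f g
  proof -
    have "ev xs f = ev (map (\<lambda>i. (x i, i)) [0..<d]) (\<lambda>i. f (c i, r i))"
      unfolding xs_def by (rule ev_map)
    also have "\<dots> = ev (map (\<lambda>i. (x i, i)) [0..<d]) g"
      by (rule ev_cong) (use that in auto)
    also have "\<dots> = (\<Oplus>i\<in>{..<d}. x i \<otimes> g i)"
      using ev_map_distinct[of "[0..<d]" x g] x(1) gc[OF that(1)] by (simp add: atLeast0LessThan)
    finally show ?thesis using x(4) that(1) by simp
  qed
  have xs: "coeffs_in xs" "\<And>y. y \<in> set xs \<Longrightarrow> fst (snd y) \<in> carrier R \<and> snd (snd y) \<in> elts"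
    using x cr(2) re by (auto simp: xs_def coeffs_in_def)
  have le: "lcomb xs \<in> elts_le n"
  proof -
    have lc: "lcomb ys \<in> elts_le n" if "coeffs_in ys" "\<And>y. y \<in> set ys \<Longrightarrow> snd (snd y) \<in> elts_le n" for ys :: "('a \<times> 'a \<times> ('a \<times> bool list) list) list"
      using that by (induction ys) auto
    show ?thesis by (rule lc[OF xs(1)]) (use cr(3) in \<open>auto simp: xs_def\<close>)
  qed
  have "approx (lcomb xs) []"
  proof (rule sep[OF le])
    fix l assume l: "l \<in> set \<Lambda>"
    have "ev (lcomb xs) l = ev xs (\<lambda>y. ev (snd y) l)"
      by (rule ev_lcomb) (use xs \<Lambda> l in auto)
    also have "\<dots> = \<zero>"
      by (rule xsum[of "\<lambda>i. ev (r i) l"]) (use l in \<open>auto simp: gs_def\<close>)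
    finally show "ev (lcomb xs) l = \<zero>" .
  qed
  moreover have "ev xs fst = \<zero>" by (rule xsum[of c]) (auto simp: gs_def)
  ultimately have "U.combine (map (\<lambda>y. (fst y, \<zero>\<^bsub>quot\<^esub>)) xs)
      (map (\<lambda>y. (fst (snd y), rep (snd (snd y)))) xs) = \<zero>\<^bsub>hull_ring\<^esub>"
    using combine_hull[OF xs] le by (simp add: quot_zero rep_eq_iff)
  moreover have "map (\<lambda>y. (fst (snd y), rep (snd (snd y)))) xs = Us"
    using Us(3) cr(1) by (auto simp: xs_def intro: nth_equalityI)
  ultimately have "set (take (length Us) (map (\<lambda>y. (fst y, \<zero>\<^bsub>quot\<^esub>)) xs)) \<subseteq> {\<zero>\<^bsub>hull_ring\<^esub>}"
    using xs(1) by (intro U.independent_imp_trivial_combine[OF subfield_scalars Us(2)])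
      (auto simp: coeffs_in_def)
  moreover have "(x j, \<zero>\<^bsub>quot\<^esub>) \<in> set (take (length Us) (map (\<lambda>y. (fst y, \<zero>\<^bsub>quot\<^esub>)) xs))"
    using x(2) Us(3) by (force simp: xs_def)
  ultimately show False using x(3) by auto
qed

text \<open>Evaluating a linear relation between the words at the functional \<open>b z\<close>
  reads off the coefficient of \<open>wd z\<close>.\<close>

lemma length_le_dimension_filtration:
  assumes dim: "U.dimension d scalars (carrier R \<times> rep ` elts_le n)"
    and zs: "distinct zs" "\<And>z. z \<in> set zs \<Longrightarrow> wd z \<noteq> [] \<and> length (wd z) \<le> n \<and> b z \<in> \<Phi>"
    and dual: "\<And>z z'. z \<in> set zs \<Longrightarrow> z' \<in> set zs \<Longrightarrow> b z (wd z') = (if z = z' then \<one> else \<zero>)"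
  shows "length zs \<le> d"
proof -
  define Us where "Us = map (\<lambda>z. (\<zero>, rep [(\<one>, wd z)])) zs"
  have UsE: "set Us \<subseteq> carrier R \<times> rep ` elts_le n"
    using zs(2) by (auto simp: Us_def)
  then have Us: "set Us \<subseteq> carrier hull_ring" by auto
  have "U.independent scalars Us"
  proof (rule ccontr)
    assume dep: "\<not> U.independent scalars Us"
    obtain Ks where Ks: "length Ks = length Us" "U.combine Ks Us = \<zero>\<^bsub>hull_ring\<^esub>" "set Ks \<subseteq> scalars"
      "set Ks \<noteq> {\<zero>\<^bsub>hull_ring\<^esub>}"
      using U.dependent_imp_non_trivial_combine[OF subfield_scalars Us dep] by blast
    have "Us \<noteq> []" using dep by auto
    then have "set Ks \<noteq> {}" using Ks(1) by auto
    then obtain j where j: "j < length zs" "Ks ! j \<noteq> \<zero>\<^bsub>hull_ring\<^esub>"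
      using Ks(1,4) by (auto simp: Us_def in_set_conv_nth set_eq_iff)
    define m where "m = length zs"
    define k where "k = (\<lambda>i. fst (Ks ! i))"
    have k: "Ks ! i = (k i, \<zero>\<^bsub>quot\<^esub>)" "k i \<in> carrier R" if "i < m" for i
    proof -
      have "Ks ! i \<in> scalars"
        using Ks(1,3) nth_mem[of i Ks] that by (auto simp: Us_def m_def simp del: mem_Sigma_iff)
      then show "Ks ! i = (k i, \<zero>\<^bsub>quot\<^esub>)" "k i \<in> carrier R"
        by (auto simp: k_def)
    qed
    define xs where "xs = map (\<lambda>i. (k i, (\<zero>, [(\<one>, wd (zs ! i))]))) [0..<m]"
    have xs: "coeffs_in xs" "\<And>y. y \<in> set xs \<Longrightarrow> fst (snd y) \<in> carrier R \<and> snd (snd y) \<in> elts"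
      using k zs(2) by (auto simp: xs_def coeffs_in_def m_def)
    have "map (\<lambda>x. (fst x, \<zero>\<^bsub>quot\<^esub>)) xs = Ks"
      using k Ks(1) by (auto simp: xs_def m_def Us_def intro!: nth_equalityI)
    moreover have "map (\<lambda>x. (fst (snd x), rep (snd (snd x)))) xs = Us"
      by (auto simp: xs_def m_def Us_def intro!: nth_equalityI)
    ultimately have "rep (lcomb xs) = rep []"
      using combine_hull[OF xs] Ks(2) by (simp add: quot_zero)
    moreover have "lcomb xs \<in> elts" by (rule lcomb_elts) (use xs in auto)
    ultimately have "approx (lcomb xs) []" by (simp add: rep_eq_iff)
    moreover have bj: "b (zs ! j) \<in> \<Phi>" using zs(2) j by auto
    ultimately have "ev (lcomb xs) (\<lambda>y. b (zs ! j) ([] @ y @ [])) = ev [] (\<lambda>y. b (zs ! j) ([] @ y @ []))"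
      unfolding approx_def by blast
    then have "\<zero> = ev (lcomb xs) (b (zs ! j))" by simp
    also have "\<dots> = ev xs (\<lambda>y. ev (snd y) (b (zs ! j)))"
      by (rule ev_lcomb) (use xs test_closed[OF bj] in auto)
    also have "\<dots> = ev (map (\<lambda>i. (k i, i)) [0..<m]) (\<lambda>i. ev [(\<one>, wd (zs ! i))] (b (zs ! j)))"
      unfolding xs_def by (subst ev_map) simp
    also have "\<dots> = ev (map (\<lambda>i. (k i, i)) [0..<m]) (\<lambda>i. if j = i then \<one> else \<zero>)"
      using zs(1) j dual by (intro ev_cong) (auto simp: m_def nth_eq_iff_index_eq)
    also have "\<dots> = (\<Oplus>i\<in>{..<m}. k i \<otimes> (if j = i then \<one> else \<zero>))"
      using ev_map_distinct[of "[0..<m]" k] k by (simp add: atLeast0LessThan)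
    also have "\<dots> = (\<Oplus>i\<in>{..<m}. if j = i then k i else \<zero>)"
      by (rule finsum_cong') (use k in auto)
    also have "\<dots> = k j"
      by (rule finsum_singleton) (use j k in \<open>auto simp: m_def\<close>)
    finally show False using j k[of j] by (simp add: m_def)
  qed
  then have "length Us \<le> d"
    using U.independent_length_le_dimension[OF subfield_scalars dim] UsE by blast
  then show ?thesis by (simp add: Us_def)
qed

lemma growth_dimension:
  assumes "nil_algebra quot" "\<phi> \<in> \<Phi>" "y \<noteq> []" "\<phi> y \<noteq> \<zero>"
  shows "U.dimension (growth R quot letter_space n) scalars (carrier R \<times> rep ` elts_le n)"
proof -
  have "growth R quot letter_space n = U.dim scalars (carrier R \<times> rep ` elts_le n)"
    using no_identity[OF assms]
    by (auto simp: growth_def growth_in_ring_def space_filtration_eq[symmetric] quot_zero)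
  then show ?thesis
    using U.finite_dimensionE[OF subfield_scalars finite_dimension_filtration]
    by (simp add: over_def)
qed

end

section \<open>One stage of the construction\<close>

text \<open>Eventually the \<open>n\<close>-th root of \<open>f n\<close> is below the
  \<open>N\<close>-th root of 2, which exceeds 1; the claim is the power with exponent
  \<open>t * N\<close> of this.\<close>

lemma subexponential_bound:
  assumes "subexponential f" "0 < N"
  shows "\<exists>T. \<forall>t\<ge>T. f (t * N) \<le> 2 ^ t"
proof -
  define b where "b = root N 2"
  have b: "1 < b" "b ^ N = 2"
    using assms(2) by (auto simp: b_def real_root_gt_1_iff)
  have "limsup (\<lambda>n. ereal (root n (real (f n)))) < ereal b"
    using assms(1) b by (simp add: subexponential_def)
  then have "eventually (\<lambda>n. ereal (root n (real (f n))) < ereal b) sequentially"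
    by (rule Limsup_lessD)
  then obtain n0 where n0: "\<And>n. n \<ge> n0 \<Longrightarrow> root n (real (f n)) < b"
    by (auto simp: eventually_sequentially)
  have "f (t * N) \<le> 2 ^ t" if "t \<ge> n0 + 1" for t
  proof -
    have pos: "0 < t * N" using that assms(2) by simp
    have "t * 1 \<le> t * N" using assms(2) by (intro mult_left_mono) auto
    then have "root (t * N) (real (f (t * N))) < b" using n0[of "t * N"] that by linarith
    then have "root (t * N) (real (f (t * N))) ^ (t * N) \<le> b ^ (t * N)"
      using pos by (intro power_mono) auto
    also have "b ^ (t * N) = 2 ^ t"
      using b(2) by (simp add: power_mult mult.commute[of t])
    finally have "real (f (t * N)) \<le> real (2 ^ t)"
      using pos by simp
    then show ?thesis by (simp only: of_nat_le_iff)
  qed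
  then show ?thesis by blast
qed

text \<open>The square of \<open>h + 1\<close>, with \<open>h\<close> half of \<open>t\<close>,
  bounds \<open>2 ^ t\<close> from below; the factor 4 in the threshold makes \<open>h + 1\<close>
  exceed twice the slope \<open>K\<close>.\<close>

lemma linear_le_exponential:
  fixes A N :: nat
  shows "\<exists>T. \<forall>t\<ge>T. A * (t * N + 1) + 2 \<le> 2 ^ t"
proof (intro exI allI impI)
  fix t :: nat
  define K where "K = A * N + A + 2"
  assume t: "t \<ge> 4 * (A * N + A + 2)"
  define h where "h = t div 2"
  have h: "2 * K \<le> h + 1" "t + 1 \<le> 2 * (h + 1)" "2 * h \<le> t"
    using t by (auto simp: h_def K_def)
  have "h + 1 \<le> 2 ^ h" using Suc_leI[OF less_exp[of h]] by simp
  then have "(h + 1) * (h + 1) \<le> 2 ^ h * 2 ^ h" by (intro mult_mono) auto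
  also have "\<dots> \<le> 2 ^ t" using h(3) by (simp flip: power_add)
  finally have "(h + 1) * (h + 1) \<le> 2 ^ t" .
  have "A * (t * N + 1) + 2 \<le> K * (t + 1)"
    by (simp add: K_def algebra_simps)
  also have "\<dots> \<le> (h + 1) * (h + 1)"
  proof -
    have "2 * (K * (t + 1)) = (2 * K) * (t + 1)" by simp
    also have "\<dots> \<le> (h + 1) * (2 * (h + 1))" by (rule mult_mono) (use h in auto)
    finally show ?thesis by simp
  qed
  also have "\<dots> \<le> 2 ^ t" by fact
  finally show "A * (t * N + 1) + 2 \<le> 2 ^ t" .
qed

lemma card_bool_lists: "card {z :: bool list. length z = t} = 2 ^ t"
  using card_lists_length_eq[of "UNIV :: bool set" t] by (simp add: card_UNIV_bool)

lemma finite_bool_lists_le: "finite {z :: bool list. length z \<le> t}"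
  using finite_lists_length_le[of "UNIV :: bool set" t] by simp

context field
begin

text \<open>
  \<open>q\<close> is a pair of combinations of the \<open>2 ^ t\<close> block functionals of length \<open>t * N\<close> chosen to
  annihilate everything that a power of \<open>a\<close> can put into a block.
\<close>

definition stage where
  "stage f N p a t q v \<longleftrightarrow> 1 \<le> t \<and> f (t * N) \<le> (2 :: nat) ^ t \<and> dual_pair (t * N) q v \<and>
     (\<exists>x. (\<forall>c z. x c z \<in> carrier R) \<and>
       (\<forall>c. q c = (\<lambda>y. \<Oplus>z\<in>{z. length z = t}. x c z \<otimes> blk N p z y))) \<and>
     (\<exists>D. (\<forall>y\<in>snd ` set a. length y \<le> D) \<and> D \<le> t * N \<and>
       (\<forall>c k w0 w1. length w0 \<le> D \<longrightarrow> length w1 \<le> D \<longrightarrow>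
         ev (pow a k) (\<lambda>y. q c (w0 @ y @ w1)) = \<zero>))"

lemma stage_exists:
  fixes w :: "bool \<Rightarrow> bool list"
  assumes dp: "dual_pair N p w" and a: "a \<in> elts" and f: "subexponential f"
  shows "\<exists>t q v. stage f N p a t q v"
proof -
  note d = dual_pairD[OF dp]
  \<comment> \<open>For an empty \<open>a\<close> this is an unspecified number, which is harmless:
    the bound is then vacuous and \<open>t\<close> is chosen above \<open>D\<close>.\<close>
  define D where "D = Max (length ` snd ` set a)"
  have D: "\<forall>y\<in>snd ` set a. length y \<le> D"
    by (simp add: D_def)
  have "finite {w :: bool list. length w \<le> D}" by (rule finite_bool_lists_le)
  then obtain ws where ws: "set ws = {w :: bool list. length w \<le> D}"
    using finite_list by blast
  define A where "A = length ws * length ws"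
  obtain T1 where T1: "\<forall>t\<ge>T1. f (t * N) \<le> 2 ^ t" using subexponential_bound[OF f d(1)] by blast
  obtain T2 where T2: "\<forall>t\<ge>T2. A * (t * N + 1) + 2 \<le> 2 ^ t" using linear_le_exponential by blast
  define t where "t = T1 + T2 + D + 1"
  have "D * 1 \<le> t * N" using d(1) by (intro mult_mono) (auto simp: t_def)
  then have "D \<le> t * N" by simp
  moreover have "T1 \<le> t" "T2 \<le> t" "1 \<le> t" by (auto simp: t_def)
  ultimately have t: "1 \<le> t" "f (t * N) \<le> 2 ^ t" "A * (t * N + 1) + 2 \<le> 2 ^ t" "D \<le> t * N"
    using T1 T2 by blast+
  define L where "L = t * N"
  have L: "0 < L" using t(1) d(1) by (simp add: L_def)
  define I where "I = {z :: bool list. length z = t}"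
  have I: "finite I" "card I = 2 ^ t"
    using card_bool_lists finite_length_eq_bool by (auto simp: I_def)
  \<comment> \<open>The unknowns are the coefficients of the tensor products, indexed by
    \<open>z\<close>. Each pair of boundary words and each exponent up to \<open>L\<close> gives one
    equation.\<close>
  define g where "g = (\<lambda>(w0, w1, k) z. ev (pow a k) (\<lambda>y. blk N p z (w0 @ y @ w1)))"
  define gs where "gs = map g (List.product ws (List.product ws [0..<L + 1]))"
  have "length gs = A * (t * N + 1)" by (simp add: gs_def A_def L_def distrib_left mult.assoc)
  then have len: "Suc (length gs) < card I" using t(3) I(2) by simp
  have gc: "h z \<in> carrier R" if "h \<in> set gs" "z \<in> I" for h z
    using that a d(2) by (auto simp: gs_def g_def)
  have "\<exists>x k. (\<forall>c i. x c i \<in> carrier R) \<and> (\<forall>c. k c \<in> I) \<and>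
      (\<forall>c d. x c (k d) = (if c = (d::bool) then \<one> else \<zero>)) \<and>
      (\<forall>c. \<forall>g\<in>set gs. (\<Oplus>i\<in>I. x c i \<otimes> g i) = \<zero>)"
    using I(1) len by (rule homogeneous_system_two_solutions) (rule gc)
  then obtain x k where x: "\<forall>c i. x c i \<in> carrier R" and k: "\<forall>c. k c \<in> I"
    and xk: "\<forall>c e. x c (k e) = (if c = (e :: bool) then \<one> else \<zero>)"
    and sol: "\<forall>c. \<forall>h\<in>set gs. (\<Oplus>i\<in>I. x c i \<otimes> h i) = \<zero>"
    by blast
  define q where "q = (\<lambda>c y. \<Oplus>z\<in>I. x c z \<otimes> blk N p z y)"
  \<comment> \<open>On this word, among patterns of length \<open>t\<close>, only the tensor product
    with pattern \<open>k c\<close> is nonzero; so \<open>q\<close> inherits the duality of the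
    normalised coefficients.\<close>
  define v where "v = (\<lambda>c. word w (k c))"
  have bc: "blk N p z y \<in> carrier R" for z y using d(2) by simp
  have qc: "q c y \<in> carrier R" for c y
    unfolding q_def by (rule finsum_closed) (use x bc in auto)
  have qs: "q c y = \<zero>" if "length y \<noteq> L" for c y
  proof -
    have "q c y = (\<Oplus>z\<in>I. \<zero>)"
      unfolding q_def
    proof (rule finsum_cong')
      fix z assume "z \<in> I"
      then have "blk N p z y = \<zero>" using that d by (intro blk_support) (auto simp: I_def L_def)
      then show "x c z \<otimes> blk N p z y = \<zero>" using x by simp
    qed auto
    then show ?thesis by simp
  qed
  have qv: "q c (v e) = (if c = e then \<one> else \<zero>)" for c e
  proof -
    have "q c (v e) = (\<Oplus>z\<in>I. if k e = z then x c z else \<zero>)"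
      unfolding q_def v_def
    proof (rule finsum_cong')
      fix z assume "z \<in> I"
      then have "blk N p z (word w (k e)) = (if z = k e then \<one> else \<zero>)"
        using k by (intro blk_word[OF dp]) (auto simp: I_def)
      then show "x c z \<otimes> blk N p z (word w (k e)) = (if k e = z then x c z else \<zero>)"
        using x by simp
    qed (use x in auto)
    also have "\<dots> = x c (k e)"
      by (rule finsum_singleton) (use k I x in auto)
    finally show ?thesis using xk by simp
  qed
  have dq: "dual_pair L q v"
    unfolding dual_pair_def
    using L qc qs qv k length_word[of w N] d(4) by (auto simp: v_def I_def L_def)
  have kill: "ev (pow a m) (\<lambda>y. q c (w0 @ y @ w1)) = \<zero>"
    if "length w0 \<le> D" "length w1 \<le> D" for c m w0 w1
  proof (cases "m \<le> L")
    case True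
    have "ev (pow a m) (\<lambda>y. q c (w0 @ y @ w1)) =
        (\<Oplus>z\<in>I. ev (pow a m) (\<lambda>y. x c z \<otimes> blk N p z (w0 @ y @ w1)))"
      unfolding q_def by (rule ev_finsum) (use a I x bc in auto)
    also have "\<dots> = (\<Oplus>z\<in>I. x c z \<otimes> g (w0, w1, m) z)"
    proof (rule finsum_cong')
      fix z assume "z \<in> I"
      show "ev (pow a m) (\<lambda>y. x c z \<otimes> blk N p z (w0 @ y @ w1)) = x c z \<otimes> g (w0, w1, m) z"
        unfolding g_def prod.case by (rule ev_mult_left) (use a x bc in auto)
    qed (use a x bc in \<open>auto simp: g_def\<close>)
    also have "g (w0, w1, m) \<in> set gs"
      using that ws True by (auto simp: gs_def)
    then have "(\<Oplus>z\<in>I. x c z \<otimes> g (w0, w1, m) z) = \<zero>" using sol by blast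
    finally show ?thesis .
  next
    \<comment> \<open>Words in this power are longer than the support of \<open>q c\<close>.\<close>
    case False
    show ?thesis
    proof (rule ev_zero)
      fix y assume "y \<in> snd ` set (pow a m)"
      then have "m \<le> length y" using a by (intro length_pow[of a] elts_nonempty)
      then show "q c (w0 @ y @ w1) = \<zero>" using False by (intro qs) auto
    qed (use a in auto)
  qed
  have "stage f N p a t q v"
    unfolding stage_def L_def[symmetric]
  proof (intro conjI)
    show "\<exists>x. (\<forall>c z. x c z \<in> carrier R) \<and>
        (\<forall>c. q c = (\<lambda>y. \<Oplus>z\<in>{z. length z = t}. x c z \<otimes> blk N p z y))"
      using x by (intro exI[of _ x]) (auto simp: q_def I_def)
    show "\<exists>D. (\<forall>y\<in>snd ` set a. length y \<le> D) \<and> D \<le> L \<and>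
        (\<forall>c k w0 w1. length w0 \<le> D \<longrightarrow> length w1 \<le> D \<longrightarrow>
          ev (pow a k) (\<lambda>y. q c (w0 @ y @ w1)) = \<zero>)"
      using D t(4) kill by (intro exI[of _ D]) (auto simp: L_def)
  qed (use t dq in \<open>auto simp: L_def\<close>)
  then show ?thesis by blast
qed

definition last_pattern :: "nat \<Rightarrow> bool \<Rightarrow> bool list" where
  "last_pattern s c = replicate (s - 1) False @ [c]"

lemma length_last_pattern [simp]: "0 < s \<Longrightarrow> length (last_pattern s c) = s"
  by (simp add: last_pattern_def)

lemma dual_pair_next:
  assumes "dual_pair L q v" "0 < s"
  shows "dual_pair (s * L) (\<lambda>c. blk L q (last_pattern s c)) (\<lambda>c. word v (last_pattern s c))"
proof -
  note d = dual_pairD[OF assms(1)]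
  have "blk L q (last_pattern s c) (word v (last_pattern s e)) = (if c = e then \<one> else \<zero>)" for c e
    using blk_word[OF assms(1), of "last_pattern s c" "last_pattern s e"] assms(2)
    by (auto simp: last_pattern_def)
  moreover have "blk L q (last_pattern s c) y = \<zero>" if "length y \<noteq> s * L" for c y
    using that d assms(2) by (intro blk_support) auto
  moreover have "length (word v (last_pattern s c)) = s * L" for c
    using length_word[of v L] d(4) assms(2) by simp
  ultimately show ?thesis
    unfolding dual_pair_def using d(1,2) assms(2) by auto
qed

text \<open>
  Large enough for \<open>stretch L ^ 6\<close> to exceed the number of functionals counted in
  \<open>card_tests\<close> below.
\<close>

definition stretch :: "nat \<Rightarrow> nat" where
  "stretch L = (L + 2) * 8 ^ (L + 1) + 2"

text \<open>Dependent choice: each stage fixes the lengths and functionals from which the next one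
  starts.\<close>

lemma tower_exists:
  assumes f: "subexponential f"
  shows "\<exists>N p w t q v. \<forall>j. dual_pair (N j) (p j) (w j :: bool \<Rightarrow> bool list) \<and>
    stage f (N j) (p j) (enum j) (t j) (q j) (v j) \<and>
    N (Suc j) = stretch (t j * N j) * (t j * N j) \<and>
    p (Suc j) = (\<lambda>c. blk (t j * N j) (q j) (last_pattern (stretch (t j * N j)) c))"
proof -
  define P where "P = (\<lambda>j (N, p, w, t, q, v). dual_pair N p (w :: bool \<Rightarrow> bool list) \<and>
      stage f N p (enum j) t q v)"
  define Q where "Q = (\<lambda>(j :: nat) (N, p :: bool \<Rightarrow> bool list \<Rightarrow> 'a, w :: bool \<Rightarrow> bool list, t, q :: bool \<Rightarrow> bool list \<Rightarrow> 'a, v :: bool \<Rightarrow> bool list)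
      (N', p', w' :: bool \<Rightarrow> bool list, t' :: nat, q' :: bool \<Rightarrow> bool list \<Rightarrow> 'a, v' :: bool \<Rightarrow> bool list).
      N' = stretch (t * N) * (t * N) \<and>
      p' = (\<lambda>c. blk (t * N) q (last_pattern (stretch (t * N)) c)))"
  have "\<exists>F. \<forall>j. P j (F j) \<and> Q j (F j) (F (Suc j))"
  proof (rule dependent_nat_choice)
    \<comment> \<open>The tower starts with the coordinate functionals of the two letters.\<close>
    define p :: "bool \<Rightarrow> bool list \<Rightarrow> 'a" where "p = (\<lambda>c y. if y = [c] then \<one> else \<zero>)"
    have dp: "dual_pair 1 p (\<lambda>c. [c])" by (auto simp: dual_pair_def p_def)
    obtain t q v where "stage f 1 p (enum 0) t q v"
      using stage_exists[OF dp enum_elts[of 0] f] by auto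
    then have "P 0 (1, p, (\<lambda>c. [c]), t, q, v)" using dp by (simp add: P_def)
    then show "\<exists>x. P 0 x" by blast
  next
    fix x j assume "P j x"
    then obtain N p w t q v where x: "x = (N, p, w, t, q, v)"
      and st: "stage f N p (enum j) t q v"
      by (auto simp: P_def split: prod.splits)
    define s where "s = stretch (t * N)"
    have "dual_pair (t * N) q v" using st by (simp add: stage_def)
    then have dp: "dual_pair (s * (t * N)) (\<lambda>c. blk (t * N) q (last_pattern s c)) (\<lambda>c. word v (last_pattern s c))"
      by (rule dual_pair_next) (simp add: s_def stretch_def)
    obtain t' q' v' where "stage f (s * (t * N)) (\<lambda>c. blk (t * N) q (last_pattern s c)) (enum (Suc j)) t' q' v'"
      using stage_exists[OF dp enum_elts[of "Suc j"] f] by auto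
    then have "P (Suc j) (s * (t * N), (\<lambda>c. blk (t * N) q (last_pattern s c)),
        (\<lambda>c. word v (last_pattern s c)), t', q', v')"
      "Q j x (s * (t * N), (\<lambda>c. blk (t * N) q (last_pattern s c)),
        (\<lambda>c. word v (last_pattern s c)), t', q', v')"
      using dp by (simp_all add: P_def Q_def x s_def)
    then show "\<exists>y. P (Suc j) y \<and> Q j x y" by blast
  qed
  then obtain F where F: "\<And>j. P j (F j)" "\<And>j. Q j (F j) (F (Suc j))" by blast
  show ?thesis
    by (rule exI[of _ "\<lambda>j. fst (F j)"], rule exI[of _ "\<lambda>j. fst (snd (F j))"],
        rule exI[of _ "\<lambda>j. fst (snd (snd (F j)))"], rule exI[of _ "\<lambda>j. fst (snd (snd (snd (F j))))"],
        rule exI[of _ "\<lambda>j. fst (snd (snd (snd (snd (F j)))))"],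
        rule exI[of _ "\<lambda>j. snd (snd (snd (snd (snd (F j)))))"])
      (use F in \<open>auto simp: P_def Q_def case_prod_beta\<close>)
qed

end

section \<open>The tower of stages\<close>

text \<open>An index beyond the pattern marks nothing and equal indices mark once, so patterns with
  no, one or two marks all have this form.\<close>

definition marked :: "nat \<Rightarrow> nat \<Rightarrow> nat \<Rightarrow> bool list" where
  "marked l i1 i2 = map (\<lambda>k. k = i1 \<or> k = i2) [0..<l]"

text \<open>Marks are at least \<open>s\<close> apart, so three of them would need more than
  \<open>2 * s\<close> places. The offset \<open>g\<close> stands for the number of blocks before
  the window.\<close>

lemma sparse_marked:
  assumes "\<And>h. h < length z \<Longrightarrow> z ! h \<Longrightarrow> s dvd g + h + (1 :: nat)" "length z \<le> s + 1" "0 < s"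
  shows "\<exists>i1\<le>s + 1. \<exists>i2\<le>s + 1. z = marked (length z) i1 i2"
proof -
  define H where "H = {h. h < length z \<and> z ! h}"
  have fin: "finite H" by (simp add: H_def)
  have gap: "h + s \<le> h'" if "h \<in> H" "h' \<in> H" "h < h'" for h h'
  proof -
    have "s dvd (g + h' + 1) - (g + h + 1)"
      using assms(1) that by (intro dvd_diff_nat) (auto simp: H_def)
    then have "s dvd h' - h" by simp
    then have "s \<le> h' - h" using that by (intro dvd_imp_le) auto
    then show ?thesis using that by simp
  qed
  show ?thesis
  proof (cases "H = {}")
    case True
    then have "z = marked (length z) (length z) (length z)"
      by (auto simp: marked_def H_def intro!: nth_equalityI)
    then show ?thesis using assms(2) by blast
  next
    case False
    define i1 i2 where "i1 = Min H" and "i2 = Max H"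
    have i: "i1 \<in> H" "i2 \<in> H" using fin False by (auto simp: i1_def i2_def)
    have "h = i1 \<or> h = i2" if "h \<in> H" for h
    proof (rule ccontr)
      assume "\<not> (h = i1 \<or> h = i2)"
      moreover have "i1 \<le> h" "h \<le> i2" using fin that by (auto simp: i1_def i2_def)
      ultimately have "i1 + s \<le> h" "h + s \<le> i2" using gap i that by auto
      moreover have "i2 < length z" using i by (simp add: H_def)
      ultimately show False using assms(2,3) by simp
    qed
    then have "H = {i1, i2}" using i by auto
    then have "h \<in> H \<longleftrightarrow> h = i1 \<or> h = i2" for h by simp
    then have "z ! h \<longleftrightarrow> h = i1 \<or> h = i2" if "h < length z" for h
      using that unfolding H_def by blast
    then have "z = marked (length z) i1 i2"
      unfolding marked_def by (intro nth_equalityI) simp_all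
    moreover have "i1 \<le> s + 1" "i2 \<le> s + 1" using i assms(2) by (auto simp: H_def)
    ultimately show ?thesis by blast
  qed
qed

lemma card_bool_lists_le: "card {z :: bool list. length z \<le> n} \<le> 2 ^ (n + 1)"
proof (induction n)
  case (Suc n)
  have "{z :: bool list. length z \<le> Suc n} = {z. length z \<le> n} \<union> {z. length z = Suc n}" by auto
  then have "card {z :: bool list. length z \<le> Suc n} \<le>
      card {z :: bool list. length z \<le> n} + card {z :: bool list. length z = Suc n}"
    by (simp only: card_Un_le)
  then show ?case using Suc card_bool_lists[of "Suc n"] by simp
qed auto

context cring
begin

text \<open>Block number \<open>g\<close> carries \<open>w c\<close> where the pattern has the other
  functional, so duality gives zero.\<close>

lemma blk_mismatch:
  assumes "dual_pair N p w" "length u = g * N" "g < length z" "z ! g \<noteq> c"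
  shows "blk N p z (u @ w c @ y) = \<zero>"
  using assms(2-)
proof (induction z arbitrary: u g)
  case (Cons b z)
  note d = dual_pairD[OF assms(1)]
  show ?case
  proof (cases g)
    case 0
    then show ?thesis using Cons.prems d by simp
  next
    case (Suc g')
    have "blk N p z (drop N u @ w c @ y) = \<zero>"
      using Cons.prems Suc by (intro Cons.IH[of _ g']) auto
    then show ?thesis using Cons.prems Suc d by simp
  qed
qed simp

end

locale tower = field R for R :: "('a, 'm) ring_scheme" (structure) +
  fixes f :: "nat \<Rightarrow> nat"
    and N :: "nat \<Rightarrow> nat" and p :: "nat \<Rightarrow> bool \<Rightarrow> bool list \<Rightarrow> 'a" and w :: "nat \<Rightarrow> bool \<Rightarrow> bool list"
    and t :: "nat \<Rightarrow> nat" and q :: "nat \<Rightarrow> bool \<Rightarrow> bool list \<Rightarrow> 'a" and v :: "nat \<Rightarrow> bool \<Rightarrow> bool list"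
  assumes countable: "countable (carrier R)"
    and dual: "dual_pair (N j) (p j) (w j)"
    and stage: "stage f (N j) (p j) (enum j) (t j) (q j) (v j)"
    and N_Suc: "N (Suc j) = stretch (t j * N j) * (t j * N j)"
    and p_Suc: "p (Suc j) = (\<lambda>c. blk (t j * N j) (q j) (last_pattern (stretch (t j * N j)) c))"
begin

section \<open>Block lengths of the tower and propagation of annihilation\<close>

definition L :: "nat \<Rightarrow> nat" where "L j = t j * N j"

definition tests :: "(bool list \<Rightarrow> 'a) set" where
  "tests = {blk (N j) (p j) z | j z. length z = t j}"

lemma stageD:
  "1 \<le> t j" "f (L j) \<le> 2 ^ t j" "dual_pair (L j) (q j) (v j)"
  using stage[of j] by (auto simp: stage_def L_def)

lemma p_closed [simp]: "p j c y \<in> carrier R"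
  using dual_pairD[OF dual] by blast

lemma q_closed [simp]: "q j c y \<in> carrier R"
  using dual_pairD[OF stageD(3)] by blast

lemma N_pos: "0 < N j" and L_pos: "0 < L j"
  using dual_pairD(1)[OF dual] dual_pairD(1)[OF stageD(3)] by blast+

lemma N_dvd: "i \<le> j \<Longrightarrow> N i dvd N j"
  by (induction rule: dec_induct) (auto simp: N_Suc intro: dvd_trans)

lemma N_dvd_L: "i \<le> j \<Longrightarrow> N i dvd L j"
  using N_dvd by (auto simp: L_def)

lemma stretch_ge: "2 \<le> stretch l"
  by (simp add: stretch_def)

lemma L_dvd_N: "L j dvd N (Suc j)"
  by (simp add: N_Suc L_def)

lemma L_less: "L j < L (Suc j)"
proof -
  have "1 * L j < stretch (L j) * L j"
    using stretch_ge[of "L j"] L_pos by (intro mult_strict_right_mono) auto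
  also have "\<dots> = N (Suc j)" by (simp add: N_Suc L_def)
  also have "\<dots> \<le> L (Suc j)" using stageD(1)[of "Suc j"] by (simp add: L_def)
  finally show ?thesis by simp
qed

lemma L_mono: "i \<le> j \<Longrightarrow> L i \<le> L j"
  by (rule lift_Suc_mono_le[of L]) (rule less_imp_le[OF L_less])

lemma le_L: "j \<le> L j"
proof (induction j)
  case (Suc j)
  then show ?case using L_less[of j] by linarith
qed simp

text \<open>Everything from stage \<open>k\<close> on arises from \<open>p k\<close> by tensor
  products and linear combinations, and both preserve \<open>kills\<close>. The block lengths
  involved are multiples of \<open>N k\<close>, so \<open>A\<close> has to respect every such
  multiple.\<close>

lemma tower_kills:
  assumes f: "coeffs_in r" "\<And>y. y \<in> snd ` set r \<Longrightarrow> length y = l" "0 < l"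
    and base: "\<And>c. kills A r (p k c)"
    and A: "\<And>a M. N k dvd M \<Longrightarrow> a \<in> A \<Longrightarrow> a < M \<Longrightarrow> a + l \<le> M"
      "\<And>a M. N k dvd M \<Longrightarrow> a \<in> A \<Longrightarrow> M \<le> a \<Longrightarrow> a - M \<in> A"
    and "k \<le> i"
  shows "kills A r (blk (N i) (p i) z)"
proof -
  have blks: "kills A r (blk (N i) (p i) z)" if "\<And>c. kills A r (p i c)" "k \<le> i" for i z
    using f p_closed that(1) A[OF N_dvd[OF that(2)]] by (rule kills_blk)
  have "kills A r (p i c)" for c
    using \<open>k \<le> i\<close>
  proof (induction i arbitrary: c rule: dec_induct)
    case base
    show ?case by (rule assms(4))
  next
    case (step i)
    obtain x where x: "\<And>c z. x c z \<in> carrier R"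
      "\<And>c. q i c = (\<lambda>y. \<Oplus>z\<in>{z. length z = t i}. x c z \<otimes> blk (N i) (p i) z y)"
      using stage[of i] unfolding stage_def by blast
    have "kills A r (q i c)" for c
      unfolding x(2) by (intro kills_finsum f finite_length_eq_bool x blks step) (auto simp: m_comm)
    moreover have "N k dvd t i * N i" using N_dvd_L[OF step(1)] by (simp add: L_def)
    ultimately show ?case
      unfolding p_Suc by (intro kills_blk[OF f] q_closed A)
  qed
  then show ?thesis using blks \<open>k \<le> i\<close> by blast
qed

text \<open>The relation has length \<open>L j\<close> and sits at multiples of \<open>L j\<close>,
  which divides all later block lengths; so \<open>tower_kills\<close> carries it upward from stage
  \<open>Suc j\<close>.\<close>

lemma late_factors:
  assumes "j < i"
  shows "factors (L j) (q j) (v j) (blk (N i) (p i) z)"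
  unfolding factors_def
proof (intro allI impI tower_kills[where l = "L j" and k = "Suc j"])
  fix y :: "bool list" assume y: "length y = L j"
  let ?r = "[(\<one>, y), (\<ominus> q j False y, v j False), (\<ominus> q j True y, v j True)]"
  note d = dual_pairD[OF stageD(3)[of j]]
  show "coeffs_in ?r" "\<And>x. x \<in> snd ` set ?r \<Longrightarrow> length x = L j"
    using y d(4) by auto
  have dv: "a + L j \<le> M" if "L j dvd a" "a < M" "L j dvd M" for a M
  proof -
    have "L j dvd M - a" using that by simp
    then have "L j \<le> M - a" using that by (intro dvd_imp_le) auto
    then show ?thesis using that by simp
  qed
  show "a + L j \<le> M" if "N (Suc j) dvd M" "a \<in> {a. L j dvd a}" "a < M" for a M
    using dv that dvd_trans[OF L_dvd_N] by blast
  show "a - M \<in> {a. L j dvd a}" if "N (Suc j) dvd M" "a \<in> {a. L j dvd a}" "M \<le> a" for a M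
    using that dvd_trans[OF L_dvd_N that(1)] by auto
  show "kills {a. L j dvd a} ?r (p (Suc j) c)" for c
    unfolding p_Suc L_def[symmetric]
  proof (rule kills_blk[where L = "L j"])
    show "kills {a. L j dvd a} ?r (q j c)" for c
      using factors_self[OF stageD(3)[of j], of c] y by (auto simp: factors_def)
  qed (use y d(4) L_pos dv in auto)
qed (use assms L_pos in auto)

text \<open>
  In \<open>last_pattern s c\<close> only the last of \<open>s\<close> consecutive sub-blocks may carry \<open>q j True\<close>.
\<close>

lemma late_kills:
  assumes "j < i" "length u = g * L j" "\<not> stretch (L j) dvd g + 1"
  shows "blk (N i) (p i) z (u @ v j True @ y) = \<zero>"
proof -
  define s where "s = stretch (L j)"
  have s: "2 \<le> s" using stretch_ge by (simp add: s_def)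
  note d = dual_pairD[OF stageD(3)[of j]]
  \<comment> \<open>Starts of the blocks that are not last in their run of \<open>s\<close>; cutting
    off multiples of \<open>s * L j\<close> letters in front preserves this set.\<close>
  define A where "A = {g * L j | g. \<not> s dvd g + 1}"
  have N': "N (Suc j) = s * L j" by (simp add: N_Suc s_def L_def)
  have "kills A [(\<one>, v j True)] (blk (N i) (p i) z)"
  proof (rule tower_kills[where l = "L j" and k = "Suc j"])
    show "kills A [(\<one>, v j True)] (p (Suc j) c)" for c
      unfolding kills_def
    proof (intro allI impI)
      fix u x :: "bool list" assume "length u \<in> A"
      then obtain h where h: "length u = h * L j" "\<not> s dvd h + 1" by (auto simp: A_def)
      have "p (Suc j) c (u @ v j True @ x) = \<zero>"
      proof (cases "h < s")
        case True
        then have "h < s - 1" using h(2) by (cases "h + 1 = s") auto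
        then have "last_pattern s c ! h = False"
          by (simp add: last_pattern_def nth_append)
        then show ?thesis
          unfolding p_Suc L_def[symmetric] s_def[symmetric] using True s
          by (intro blk_mismatch[OF stageD(3) h(1)]) auto
      next
        case False
        then have "s * L j \<le> h * L j" by (intro mult_right_mono) auto
        then have "N (Suc j) < length (u @ v j True @ x)"
          using h(1) N' d(4)[of True] L_pos[of j] unfolding length_append by linarith
        then have "length (u @ v j True @ x) \<noteq> N (Suc j)" by linarith
        then show ?thesis by (rule dual_pairD(3)[OF dual])
      qed
      then show "ev [(\<one>, v j True)] (\<lambda>y. p (Suc j) c (u @ y @ x)) = \<zero>" by simp
    qed
    fix a M assume M: "N (Suc j) dvd M" "a \<in> A"
    obtain m where m: "M = s * L j * m"
      using M(1) unfolding N' by (rule dvdE)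
    obtain h where h: "a = h * L j" "\<not> s dvd h + 1"
      using M(2) unfolding A_def by blast
    have M': "M = (s * m) * L j" by (simp add: m)
    show "a + L j \<le> M" if "a < M"
    proof -
      have "h < s * m" using that L_pos unfolding M' h by simp
      then have "(h + 1) * L j \<le> (s * m) * L j" by (intro mult_right_mono) auto
      then show ?thesis by (simp add: M' h algebra_simps)
    qed
    show "a - M \<in> A" if "M \<le> a"
    proof -
      have le: "s * m \<le> h" using that L_pos unfolding M' h by simp
      have "\<not> s dvd (h - s * m) + 1"
      proof
        assume "s dvd (h - s * m) + 1"
        then have "s dvd (h - s * m + 1) + s * m" by (rule dvd_add) simp
        moreover have "(h - s * m + 1) + s * m = h + 1" using le by simp
        ultimately show False using h(2) by (simp only:)
      qed
      moreover have "a - M = (h - s * m) * L j" by (simp add: M' h diff_mult_distrib)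
      ultimately show ?thesis unfolding A_def by blast
    qed
  qed (use assms d(4) L_pos in auto)
  moreover have "length u \<in> A" using assms by (auto simp: A_def s_def)
  ultimately have "ev [(\<one>, v j True)] (\<lambda>x. blk (N i) (p i) z (u @ x @ y)) = \<zero>"
    by (auto simp: kills_def)
  then show ?thesis by simp
qed

lemma tests_support:
  assumes "length z = t i" "length y \<noteq> L i"
  shows "blk (N i) (p i) z y = \<zero>"
  using assms dual_pairD[OF dual[of i]] by (intro blk_support) (auto simp: L_def)

end

sublocale tower \<subseteq> T: test_family R tests
  by unfold_locales (auto simp: tests_def countable)

context tower
begin

text \<open>For the \<open>j\<close>-th element the exponent \<open>2 * L j + 1\<close> works: tests
  of stages up to \<open>j\<close> live on shorter words, and later ones act on aligned blocks
  through \<open>q j\<close>, so \<open>factors_ev_pow\<close> applies.\<close>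

lemma nil_tower: "nil_algebra T.quot"
proof (rule T.nil_algebra_quot)
  fix a assume a: "a \<in> elts"
  obtain j where j: "enum j = a" using enum_surj[OF countable a] by blast
  have a': "coeffs_in a" "[] \<notin> snd ` set a" using a elts_nonempty by auto
  have "\<exists>D. (\<forall>y\<in>snd ` set a. length y \<le> D) \<and> D \<le> L j \<and>
      (\<forall>c k w0 w1. length w0 \<le> D \<longrightarrow> length w1 \<le> D \<longrightarrow>
        ev (pow a k) (\<lambda>y. q j c (w0 @ y @ w1)) = \<zero>)"
    using stage[of j] unfolding stage_def j L_def[symmetric] by (elim conjE)
  then obtain D where D': "(\<forall>y\<in>snd ` set a. length y \<le> D) \<and> D \<le> L j \<and>
      (\<forall>c k w0 w1. length w0 \<le> D \<longrightarrow> length w1 \<le> D \<longrightarrow>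
        ev (pow a k) (\<lambda>y. q j c (w0 @ y @ w1)) = \<zero>)"
    by (rule exE)
  have D: "length y \<le> D" if "y \<in> snd ` set a" for y
    using conjunct1[OF D'] that by (rule bspec)
  have DL: "D \<le> L j" using D' by simp
  have kill: "ev (pow a k) (\<lambda>y. q j c (w0 @ y @ w1)) = \<zero>"
    if "length w0 \<le> D" "length w1 \<le> D" for c k w0 w1
    using D' that by simp
  have "ev (pow a (Suc (2 * L j))) (\<lambda>y. \<phi> (u @ y @ x)) = \<zero>" if \<phi>: "\<phi> \<in> tests" for \<phi> u x
  proof -
    obtain i z where i: "\<phi> = blk (N i) (p i) z" "length z = t i"
      using \<phi> by (auto simp: tests_def)
    show ?thesis
    proof (cases "i \<le> j")
      case True
      show ?thesis
      proof (rule ev_zero)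
        fix y assume "y \<in> snd ` set (pow a (Suc (2 * L j)))"
        then have "Suc (2 * L j) \<le> length y" by (rule length_pow[OF a'(2)])
        then have "length (u @ y @ x) \<noteq> L i" using L_mono[OF True] by simp
        then show "\<phi> (u @ y @ x) = \<zero>" unfolding i(1) by (rule tests_support[OF i(2)])
      qed (use a' coeffs_in_pow in blast)
    next
      case False
      show ?thesis
        unfolding i(1)
        by (rule factors_ev_pow[OF stageD(3)[of j] late_factors _ a' D DL kill]) (use False in auto)
    qed
  qed
  then show "\<exists>m. \<forall>\<phi>\<in>tests. \<forall>u x. ev (pow a (Suc m)) (\<lambda>y. \<phi> (u @ y @ x)) = \<zero>"
    by blast
qed

lemma growth_dim:
  "T.U.dimension (growth R T.quot T.letter_space n) T.scalars (carrier R \<times> T.rep ` T.elts_le n)"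
proof -
  define z where "z = replicate (t 0) False"
  have "length z = t 0" by (simp add: z_def)
  then have "blk (N 0) (p 0) z \<in> tests" unfolding tests_def by blast
  moreover have "blk (N 0) (p 0) z (word (w 0) z) \<noteq> \<zero>"
    using blk_word[OF dual, of z z 0] by simp
  moreover have "word (w 0) z \<noteq> []"
    using length_word[of "w 0" "N 0" z] dual_pairD(4)[OF dual] N_pos[of 0] stageD(1)[of 0]
    by (auto simp: z_def)
  ultimately show ?thesis by (intro T.growth_dimension[OF nil_tower])
qed

section \<open>Growth bounds at the two kinds of lengths\<close>

lemma growth_lower: "f (L j) \<le> growth R T.quot T.letter_space (L j)"
proof -
  obtain zs where zs: "set zs = {z :: bool list. length z = t j}" "distinct zs"
    using finite_distinct_list[OF finite_length_eq_bool] by blast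
  have "length zs = 2 ^ t j"
    using distinct_card[OF zs(2)] zs(1) card_bool_lists by simp
  moreover have "length zs \<le> growth R T.quot T.letter_space (L j)"
  proof (rule T.length_le_dimension_filtration[OF growth_dim zs(2)])
    fix z assume z: "z \<in> set zs"
    have "length (word (w j) z) = L j"
      using length_word[of "w j" "N j" z] dual_pairD(4)[OF dual] z zs by (simp add: L_def)
    moreover from this have "word (w j) z \<noteq> []"
      using L_pos[of j] by (metis less_irrefl list.size(3))
    moreover have "blk (N j) (p j) z \<in> tests" using z zs by (auto simp: tests_def)
    ultimately show "word (w j) z \<noteq> [] \<and> length (word (w j) z) \<le> L j \<and> blk (N j) (p j) z \<in> tests"
      by (metis order_refl)
    show "blk (N j) (p j) z (word (w j) z') = (if z = z' then \<one> else \<zero>)" if "z' \<in> set zs" for z'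
      using z that zs by (intro blk_word[OF dual]) auto
  qed
  ultimately show ?thesis using stageD(2)[of j] by simp
qed

text \<open>Contexts longer than \<open>L j\<close> give zero at stages up to \<open>j\<close>, and
  \<open>t i \<le> L j\<close>. Bounding everything by \<open>L j\<close> makes the count depend on
  \<open>L j\<close> alone.\<close>

definition early_tests :: "nat \<Rightarrow> (bool list \<Rightarrow> 'a) set" where
  "early_tests j = (\<lambda>(i, z, u, x) y. blk (N i) (p i) z (u @ y @ x)) `
     ({..j} \<times> {z. length z \<le> L j} \<times> {u. length u \<le> L j} \<times> {x. length x \<le> L j})"

text \<open>The words \<open>u\<close> and \<open>x\<close> complete the first and last blocks of a
  window, \<open>l\<close> counts its blocks, and \<open>i1\<close>, \<open>i2\<close> are the
  possible places of \<open>q j True\<close>.\<close>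

definition late_tests :: "nat \<Rightarrow> (bool list \<Rightarrow> 'a) set" where
  "late_tests j = (\<lambda>(u, x, l, i1, i2) y. blk (L j) (q j) (marked l i1 i2) (u @ y @ x)) `
     ({u. length u \<le> L j} \<times> {x. length x \<le> L j} \<times>
      {..stretch (L j) + 1} \<times> {..stretch (L j) + 1} \<times> {..stretch (L j) + 1})"

text \<open>
  Expanding a later functional along the blocks of length \<open>L j\<close> gives one term for each pattern
  of blocks. By \<open>late_kills\<close> a pattern over at most \<open>stretch (L j) + 1\<close> blocks contributes only if
  it has at most two marks, and there are only polynomially many of these.
\<close>

lemma late_separation:
  assumes r: "r \<in> T.elts_le (N (Suc j))" and "\<And>l. l \<in> late_tests j \<Longrightarrow> ev r l = \<zero>"
    and i: "j < i" "length z = t i"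
  shows "ev r (\<lambda>y. blk (N i) (p i) z (u @ y @ x)) = \<zero>"
proof (cases "length u + length x \<le> L i \<and> L i \<le> length u + length x + N (Suc j)")
  case False
  show ?thesis
  proof (rule ev_zero)
    fix y assume "y \<in> snd ` set r"
    then have "length y \<le> N (Suc j)" using r unfolding T.elts_le_def by blast
    then show "blk (N i) (p i) z (u @ y @ x) = \<zero>"
      using False by (intro tests_support[OF i(2)]) auto
  qed (use r in auto)
next
  case True
  define s where "s = stretch (L j)"
  have s: "2 \<le> s" using stretch_ge by (simp add: s_def)
  note d = dual_pairD[OF stageD(3)[of j]]
  let ?\<phi> = "blk (N i) (p i) z"
  have N': "N (Suc j) = s * L j" by (simp add: N_Suc s_def L_def)
  \<comment> \<open>The only length of \<open>y\<close> at which this test can be nonzero.\<close>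
  define k where "k = L i - length u - length x"
  have k: "length u + k + length x = L i" "k \<le> s * L j" using True by (auto simp: k_def N')
  define g where "g = length u div L j"
  define u1 where "u1 = take (g * L j) u"
  define u3 where "u3 = drop (g * L j) u"
  have gu: "g * L j + length u mod L j = length u" by (simp add: g_def)
  have "length u mod L j < L j" using L_pos by simp
  then have "g * L j \<le> length u" "length u - g * L j < L j" using gu by linarith+
  then have u: "u = u1 @ u3" "length u1 = g * L j" "length u3 < L j"
    by (auto simp: u1_def u3_def)
  \<comment> \<open>Rounding up gives the number of blocks covering the window, the first of them
    starting at \<open>g * L j\<close>.\<close>
  define l where "l = (length u3 + k + L j - 1) div L j"
  have l: "length u3 + k \<le> l * L j" "l * L j < length u3 + k + L j"
  proof -
    have "(length u3 + k + L j - 1) mod L j < L j" using L_pos by simp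
    moreover have "l * L j + (length u3 + k + L j - 1) mod L j = length u3 + k + L j - 1"
      by (simp add: l_def)
    ultimately show "length u3 + k \<le> l * L j" "l * L j < length u3 + k + L j"
      using L_pos[of j] by linarith+
  qed
  \<comment> \<open>The remnant \<open>u3\<close> and the rounding each add less than one block to
    the \<open>s\<close> blocks of \<open>k\<close>.\<close>
  have ls: "l \<le> s + 1"
  proof -
    have "l * L j < (s + 2) * L j" using l(2) u(3) k(2) by (simp add: algebra_simps)
    then have "l < s + 2" by (rule mult_less_cancel2[THEN iffD1, THEN conjunct2])
    then show ?thesis by simp
  qed
  \<comment> \<open>The total length being a multiple of \<open>L j\<close>, the suffix
    \<open>x\<close> is long enough to complete the last block of the window.\<close>
  have "L j dvd L i"
    using dvd_trans[OF L_dvd_N[of j] N_dvd_L[of "Suc j" i]] i(1) by simp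
  moreover have eq: "L i = g * L j + (length u3 + k + length x)" using k(1) u by simp
  ultimately have "L j dvd length u3 + k + length x"
    by (metis dvd_add_right_iff dvd_triv_right)
  then obtain m where m: "length u3 + k + length x = m * L j"
    by (metis dvdE mult.commute)
  have "l \<le> m"
  proof -
    have "l * L j < (m + 1) * L j" using l(2) m by (simp add: algebra_simps)
    then have "l < m + 1" by (rule mult_less_cancel2[THEN iffD1, THEN conjunct2])
    then show ?thesis by simp
  qed
  then have lm: "l * L j \<le> m * L j" by (intro mult_right_mono) auto
  define e where "e = l * L j - (length u3 + k)"
  define x1 where "x1 = take e x"
  define x2 where "x2 = drop e x"
  have "e \<le> length x" "e < L j" using lm m l unfolding e_def by linarith+
  then have x: "x = x1 @ x2" "length x1 = e" "e < L j"
    by (auto simp: x1_def x2_def)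
  have len: "length (u3 @ y @ x1) = l * L j \<longleftrightarrow> length y = k" for y :: "bool list"
    using x(2) l(1) unfolding e_def length_append by linarith
  define G where "G = (\<lambda>\<pi>. ?\<phi> (u1 @ word (v j) \<pi> @ x2))"
  have Gc: "G \<pi> \<in> carrier R" for \<pi> by (simp add: G_def)
  \<comment> \<open>At lengths other than \<open>k\<close> both sides vanish by support. The
    identity thus holds for all \<open>y\<close> and can be evaluated on \<open>r\<close> without
    sorting its words by length.\<close>
  have expand: "?\<phi> (u @ y @ x) = (\<Oplus>\<pi>\<in>{\<pi>. length \<pi> = l}. blk (L j) (q j) \<pi> (u3 @ y @ x1) \<otimes> G \<pi>)" for y
  proof (cases "length y = k")
    case True
    then have "length (u3 @ y @ x1) = l * L j" by (rule len[THEN iffD2])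
    then show ?thesis
      using factors_expand[OF stageD(3) late_factors[OF i(1), of z], of u1 "u3 @ y @ x1" l x2]
      by (simp add: u(1,2) x(1) G_def)
  next
    case False
    then have "length (u3 @ y @ x1) \<noteq> l * L j" using len by blast
    then have "blk (L j) (q j) \<pi> (u3 @ y @ x1) = \<zero>" if "length \<pi> = l" for \<pi>
      using that d(2,3) by (intro blk_support) auto
    then have "(\<Oplus>\<pi>\<in>{\<pi>. length \<pi> = l}. blk (L j) (q j) \<pi> (u3 @ y @ x1) \<otimes> G \<pi>) =
        (\<Oplus>\<pi>\<in>{\<pi> :: bool list. length \<pi> = l}. \<zero>)"
      by (intro finsum_cong') (auto simp: Gc)
    moreover have "?\<phi> (u @ y @ x) = \<zero>"
      using False k(1) by (intro tests_support[OF i(2)]) auto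
    ultimately show ?thesis by simp
  qed
  have "ev r (\<lambda>y. ?\<phi> (u @ y @ x)) =
      (\<Oplus>\<pi>\<in>{\<pi>. length \<pi> = l}. ev r (\<lambda>y. blk (L j) (q j) \<pi> (u3 @ y @ x1) \<otimes> G \<pi>))"
    unfolding expand by (rule ev_finsum) (use r finite_length_eq_bool Gc in auto)
  also have "\<dots> = (\<Oplus>\<pi>\<in>{\<pi> :: bool list. length \<pi> = l}. \<zero>)"
  proof (rule finsum_cong')
    fix \<pi> :: "bool list" assume "\<pi> \<in> {\<pi>. length \<pi> = l}"
    then have \<pi>: "length \<pi> = l" by simp
    have "ev r (\<lambda>y. blk (L j) (q j) \<pi> (u3 @ y @ x1)) \<otimes> G \<pi> = \<zero>"
    proof (cases "\<forall>h<length \<pi>. \<pi> ! h \<longrightarrow> s dvd g + h + 1")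
      case True
      then obtain i1 i2 where "i1 \<le> s + 1" "i2 \<le> s + 1" "\<pi> = marked l i1 i2"
        using sparse_marked[of \<pi> s g] \<pi> ls s by auto
      then have "(\<lambda>y. blk (L j) (q j) \<pi> (u3 @ y @ x1)) \<in> late_tests j"
        unfolding late_tests_def s_def[symmetric] using u(3) x(2,3) ls
        by (intro image_eqI[of _ _ "(u3, x1, l, i1, i2)"]) auto
      then show ?thesis using assms(2) Gc by simp
    next
      case False
      \<comment> \<open>Counted from the start of the whole word this is block \<open>g + h\<close>;
        it is not last in its run, so \<open>late_kills\<close> applies.\<close>
      then obtain h where h: "h < length \<pi>" "\<pi> ! h" "\<not> s dvd g + h + 1" by blast
      have "\<pi> = take h \<pi> @ True # drop (Suc h) \<pi>"
        using id_take_nth_drop[OF h(1)] h(2) by simp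
      then have "word (v j) \<pi> = word (v j) (take h \<pi>) @ v j True @ word (v j) (drop (Suc h) \<pi>)"
        by (metis concat.simps(2) concat_append list.simps(9) map_append)
      then have "G \<pi> = ?\<phi> ((u1 @ word (v j) (take h \<pi>)) @ v j True @ (word (v j) (drop (Suc h) \<pi>) @ x2))"
        by (simp add: G_def)
      also have "\<dots> = \<zero>"
        using h u(2) length_word[of "v j" "L j" "take h \<pi>"] d(4)
        by (intro late_kills[OF i(1), where g = "g + h"]) (auto simp: s_def algebra_simps)
      finally show ?thesis using r by simp
    qed
    then show "ev r (\<lambda>y. blk (L j) (q j) \<pi> (u3 @ y @ x1) \<otimes> G \<pi>) = \<zero>"
      using r Gc by (simp add: ev_mult_right)
  qed auto
  finally show ?thesis by simp
qed

lemma early_separation: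
  assumes r: "r \<in> elts" and "\<And>l. l \<in> early_tests j \<Longrightarrow> ev r l = \<zero>"
    and i: "i \<le> j" "length z = t i"
  shows "ev r (\<lambda>y. blk (N i) (p i) z (u @ y @ x)) = \<zero>"
proof (cases "length u \<le> L j \<and> length x \<le> L j")
  case True
  have "t i \<le> L i" using N_pos[of i] by (simp add: L_def Suc_le_eq)
  then have "t i \<le> L j" using L_mono[OF i(1)] by (rule order_trans)
  then have "(\<lambda>y. blk (N i) (p i) z (u @ y @ x)) \<in> early_tests j"
    unfolding early_tests_def using True i by (intro image_eqI[of _ _ "(i, z, u, x)"]) auto
  then show ?thesis by (rule assms(2))
next
  case False
  show ?thesis
  proof (rule ev_zero)
    fix y
    show "blk (N i) (p i) z (u @ y @ x) = \<zero>"
      using False L_mono[OF i(1)] by (intro tests_support[OF i(2)]) auto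
  qed (use r in simp)
qed

text \<open>The base 8 counts pattern, prefix and suffix, the base 4 only prefix and suffix, and the
  cube counts \<open>l\<close>, \<open>i1\<close> and \<open>i2\<close>. The number of early stages
  is bounded through \<open>le_L\<close>.\<close>

lemma card_tests:
  "card (early_tests j \<union> late_tests j) \<le>
     (L j + 1) * 8 ^ (L j + 1) + 4 ^ (L j + 1) * (stretch (L j) + 2) ^ 3"
proof -
  let ?B = "{z :: bool list. length z \<le> L j}" and ?S = "{..stretch (L j) + 1}"
  have fin: "finite ?B" by (rule finite_bool_lists_le)
  have cB: "card ?B \<le> 2 ^ (L j + 1)" by (rule card_bool_lists_le)
  have "card (early_tests j) \<le> card ({..j} \<times> ?B \<times> ?B \<times> ?B)"
    unfolding early_tests_def by (rule card_image_le) (simp add: fin)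
  also have "\<dots> = (j + 1) * (card ?B * (card ?B * card ?B))"
    by (simp add: card_cartesian_product)
  also have "\<dots> \<le> (L j + 1) * (2 ^ (L j + 1) * (2 ^ (L j + 1) * 2 ^ (L j + 1)))"
    using cB le_L[of j] by (intro mult_mono) auto
  also have "2 ^ (L j + 1) * (2 ^ (L j + 1) * 2 ^ (L j + 1)) = (8 :: nat) ^ (L j + 1)"
    by (simp flip: power_mult_distrib)
  finally have early: "card (early_tests j) \<le> (L j + 1) * 8 ^ (L j + 1)" .
  have "card (late_tests j) \<le> card (?B \<times> ?B \<times> ?S \<times> ?S \<times> ?S)"
    unfolding late_tests_def by (rule card_image_le) (simp add: fin)
  also have "\<dots> = card ?B * card ?B * (stretch (L j) + 2) ^ 3"
  proof -
    have "card ?S = stretch (L j) + 2" by simp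
    then show ?thesis by (simp only: card_cartesian_product power3_eq_cube mult.assoc)
  qed
  also have "\<dots> \<le> 2 ^ (L j + 1) * 2 ^ (L j + 1) * (stretch (L j) + 2) ^ 3"
    using cB by (intro mult_mono) auto
  also have "2 ^ (L j + 1) * 2 ^ (L j + 1) = (4 :: nat) ^ (L j + 1)"
    by (simp flip: power_mult_distrib)
  finally have "card (late_tests j) \<le> 4 ^ (L j + 1) * (stretch (L j) + 2) ^ 3" .
  then show ?thesis using early card_Un_le[of "early_tests j" "late_tests j"] by linarith
qed

lemma growth_upper: "growth R T.quot T.letter_space (N (Suc j)) \<le> N (Suc j) ^ 6"
proof -
  let ?\<Lambda> = "early_tests j \<union> late_tests j"
  have "finite ?\<Lambda>" by (simp add: early_tests_def late_tests_def finite_bool_lists_le)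
  then obtain \<Lambda> where \<Lambda>: "set \<Lambda> = ?\<Lambda>" "distinct \<Lambda>" using finite_distinct_list by blast
  have "growth R T.quot T.letter_space (N (Suc j)) \<le> Suc (length \<Lambda>)"
  proof (rule T.dimension_filtration_le[OF growth_dim])
    show "l y \<in> carrier R" if "l \<in> set \<Lambda>" for l y
      using that by (auto simp: \<Lambda>(1) early_tests_def late_tests_def)
    fix r assume r: "r \<in> T.elts_le (N (Suc j))" and zero: "\<And>l. l \<in> set \<Lambda> \<Longrightarrow> ev r l = \<zero>"
    show "T.approx r []"
      unfolding T.approx_def
    proof (intro ballI allI)
      fix \<phi> u x assume "\<phi> \<in> tests"
      then obtain i z where i: "\<phi> = blk (N i) (p i) z" "length z = t i" by (auto simp: tests_def)
      have "ev r (\<lambda>y. \<phi> (u @ y @ x)) = \<zero>"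
      proof (cases "i \<le> j")
        case True
        then show ?thesis
          unfolding i(1) using r zero \<Lambda>(1) i(2) by (intro early_separation) auto
      next
        case False
        then show ?thesis
          unfolding i(1) using r zero \<Lambda>(1) i(2) by (intro late_separation) auto
      qed
      then show "ev r (\<lambda>y. \<phi> (u @ y @ x)) = ev [] (\<lambda>y. \<phi> (u @ y @ x))" by simp
    qed
  qed
  also have "\<dots> \<le> 1 + ((L j + 1) * 8 ^ (L j + 1) + 4 ^ (L j + 1) * (stretch (L j) + 2) ^ 3)"
    using card_tests[of j] distinct_card[OF \<Lambda>(2)] \<Lambda>(1) by simp
  also have "\<dots> \<le> stretch (L j) ^ 6"
  proof -
    define s where "s = stretch (L j)"
    define E :: nat where "E = 8 ^ (L j + 1)"
    have sE: "s = (L j + 2) * E + 2" by (simp add: s_def stretch_def E_def)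
    have "E \<ge> 1" by (simp add: E_def)
    then have s3: "3 \<le> s" unfolding sE by (simp add: Suc_le_eq)
    have a: "1 + (L j + 1) * E \<le> s" unfolding sE by simp
    have "(4 :: nat) ^ (L j + 1) \<le> E" unfolding E_def by (intro power_mono) auto
    also have "E \<le> s" unfolding sE by simp
    finally have b: "4 ^ (L j + 1) \<le> s" .
    have c: "(s + 2) ^ 3 \<le> (2 * s) ^ 3" using s3 by (intro power_mono) auto
    \<comment> \<open>Three factors \<open>s\<close> come from the patterns and one bounds the
      constant \<open>4 ^ (L j + 1)\<close>; the remaining factor 9 is absorbed by
      \<open>s * s\<close>, which gives the exponent 6.\<close>
    have "1 + ((L j + 1) * E + 4 ^ (L j + 1) * (s + 2) ^ 3) \<le> s + s * (2 * s) ^ 3"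
      using add_mono[OF a mult_mono[OF b c]] by (simp only: add.assoc)
    also have "\<dots> = s + 8 * s ^ 4" by (simp add: power4_eq_xxxx power3_eq_cube)
    also have "\<dots> \<le> s ^ 4 + 8 * s ^ 4" using s3 self_le_power[of s 4] by simp
    also have "\<dots> = 3 * 3 * s ^ 4" by simp
    also have "\<dots> \<le> s * s * s ^ 4" by (intro mult_mono s3) auto
    also have "\<dots> = s ^ 6" by (simp add: eval_nat_numeral)
    finally show ?thesis by (simp add: s_def E_def)
  qed
  also have "\<dots> \<le> N (Suc j) ^ 6"
    using L_pos[of j] by (intro power_mono) (auto simp: N_Suc L_def)
  finally show ?thesis .
qed

lemma le_N_Suc: "j \<le> N (Suc j)"
proof -
  have "1 * L j \<le> stretch (L j) * L j" using stretch_ge[of "L j"] by (intro mult_right_mono) auto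
  then have "L j \<le> N (Suc j)" by (simp only: N_Suc L_def mult_1)
  then show ?thesis using le_L[of j] by linarith
qed

end

theorem theoremB1:
  fixes F :: "('k, 'm) ring_scheme" and f :: "nat \<Rightarrow> nat"
  assumes "field F" and "countable (carrier F)"
    and "subexponential f"
  shows "\<exists>(R :: ('k, nat) module) V.
           assoc_algebra F R \<and> nil_algebra R \<and> generating_subspace F R V \<and>
           (\<forall>\<epsilon>::real. \<epsilon> > 0 \<longrightarrow>
              (\<exists>\<^sub>\<infinity>n. real (growth F R V n) \<le> real n powr (6 + \<epsilon>))) \<and>
           (\<exists>\<^sub>\<infinity>n. growth F R V n \<ge> f n)"
proof -
  interpret field F by (rule assms(1))
  obtain N p w t q v where tower: "\<And>j. dual_pair (N j) (p j) (w j :: bool \<Rightarrow> bool list) \<and>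
      stage f (N j) (p j) (enum j) (t j) (q j) (v j) \<and>
      N (Suc j) = stretch (t j * N j) * (t j * N j) \<and>
      p (Suc j) = (\<lambda>c. blk (t j * N j) (q j) (last_pattern (stretch (t j * N j)) c))"
    using tower_exists[OF assms(3)] by blast
  interpret tower F f N p w t q v
    by unfold_locales (use tower assms(2) in auto)
  have upper: "\<exists>\<^sub>\<infinity>n. real (growth F T.quot T.letter_space n) \<le> real n powr (6 + \<epsilon>)" if "\<epsilon> > 0" for \<epsilon> :: real
    unfolding INFM_nat_le
  proof
    fix m
    \<comment> \<open>The bound holds along these lengths, which are unbounded by
      \<open>le_N_Suc\<close>.\<close>
    let ?n = "N (Suc m)"
    have "real (growth F T.quot T.letter_space ?n) \<le> real (?n ^ 6)"
      using growth_upper[of m] by (simp only: of_nat_le_iff)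
    also have "\<dots> = real ?n powr 6"
      using N_pos[of "Suc m"] by (simp add: powr_numeral)
    also have "\<dots> \<le> real ?n powr (6 + \<epsilon>)"
      using N_pos[of "Suc m"] that by (intro powr_mono) auto
    finally show "\<exists>n\<ge>m. real (growth F T.quot T.letter_space n) \<le> real n powr (6 + \<epsilon>)"
      using le_N_Suc[of m] by blast
  qed
  have lower: "\<exists>\<^sub>\<infinity>n. growth F T.quot T.letter_space n \<ge> f n"
    unfolding INFM_nat_le using growth_lower le_L by blast
  show ?thesis
    using T.assoc_algebra_quot nil_tower T.generating_letter_space upper lower by blast
qed

end
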